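(* Let $n\in\mathbb{N}$ and let $T$ be the monoid with identity element $e$ generated by $\sigma_i,\theta_i$ ($i=1,\dots,n-1$) and $\vartheta_i$ ($i=1,\dots,n$), subject to the following relations, for all indices $i,j$ for which the expressions make sense: (1) $\sigma_i^2=e$; $\sigma_i\sigma_j=\sigma_j\sigma_i$ if $|i-j|>1$; $\sigma_i\sigma_j\sigma_i=\sigma_j\sigma_i\sigma_j$ if $|i-j|=1$; (2) $\theta_i^2=\theta_i$; $\theta_i\theta_j=\theta_j\theta_i$ if $|i-j|>1$; $\theta_i\theta_j\theta_i=\theta_i$ if $|i-j|=1$; (3) $\theta_i\sigma_i=\sigma_i\theta_i=\theta_i$; $\theta_i\sigma_j=\sigma_j\theta_i$ if $|i-j|>1$; (4) $\sigma_i\theta_j\theta_i=\sigma_j\theta_i$ and $\theta_i\theta_j\sigma_i=\theta_i\sigma_j$ if $|i-j|=1$; (5) $\vartheta_i^2=\vartheta_i$; $\vartheta_i\vartheta_j=\vartheta_j\vartheta_i$ if $i\neq j$; (6) $\sigma_i\vartheta_i=\vartheta_{i+1}\sigma_i$; $\sigma_i\vartheta_j=\vartheta_j\sigma_i$ if $j\ne i,i+1$; $\vartheta_i\sigma_i\vartheta_i=\vartheta_i\vartheta_{i+1}$; (7) $\theta_i\vartheta_j=\vartheta_j\theta_i$ if $j\neq i,i+1$; (8) $\theta_i\vartheta_i=\theta_i\vartheta_{i+1}=\theta_i\vartheta_i\vartheta_{i+1}$ and $\vartheta_i\theta_i=\vartheta_{i+1}\theta_i=\vartheta_i\vartheta_{i+1}\theta_i$;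 (9) $\theta_i\vartheta_i\theta_i=\theta_i$ and $\vartheta_i\theta_i\vartheta_i=\vartheta_i\vartheta_{i+1}$. Then the map $\sigma_i\mapsto s_i$, $\theta_i\mapsto\pi_i$ ($i=1,\dots,n-1$), $\vartheta_i\mapsto\varsigma_i$ ($i=1,\dots,n$) extends to an isomorphism of monoids $\varphi:T\to\mathcal{P}\mathfrak{B}_n$.
   Context: Let $M=\{1,\dots,n\}$ and let $M'=\{1',\dots,n'\}$ be a disjoint copy of $M$. The partition monoid $\mathfrak{C}_n$ is the set of all partitions (into nonempty blocks) of $M\cup M'$ with the following product. For $\alpha,\beta\in\mathfrak{C}_n$, identify each element $i'$ of $\alpha$ with the element $i$ of $\beta$ (a middle row $M''$), take the smallest equivalence relation on (left row $M$ of $\alpha$) $\cup M''\cup$ (right row $M'$ of $\beta$) containing both block relations, and restrict it to $M\cup M'$; the resulting partition is $\alpha\beta$ (components lying entirely in the middle row are discarded). The identity is the partition with blocks $\{j,j'\}$, $j\in M$. $\mathcal{P}\mathfrak{B}_n$ (the partial Brauer monoid, or rook Brauer monoid) is the submonoid of $\mathfrak{C}_n$ of all partitions all of whose blocks have at most $2$ elements. $s_i$ ($1\le i\le n-1$) has blocks $\{i,(i+1)'\}$, $\{i+1,i'\}$ and $\{j,j'\}$ for $j\ne i,i+1$; $\pi_i$ ($1\le i\le n-1$) has blocks $\{i,i+1\}$, $\{i',(i+1)'\}$ and $\{j,j'\}$ for $j\neq i,i+1$; $\varsigma_i$ ($1\le i\le n$) has blocks $\{i\}$, $\{i'\}$ and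 $\{j,j'\}$ for $j\ne i$. *)

theory Defs
  imports "HOL-Algebra.Group" "HOL-Library.Disjoint_Sets"
begin

text \<open>The smallest congruence on the free monoid \<open>lists A\<close> that contains the
  relations \<open>R\<close>.\<close>

inductive_set pres_cong :: "'a set \<Rightarrow> ('a list \<times> 'a list) set \<Rightarrow> ('a list \<times> 'a list) set"
  for A R where
  rel: "(u, v) \<in> R \<Longrightarrow> u \<in> lists A \<Longrightarrow> v \<in> lists A \<Longrightarrow> (u, v) \<in> pres_cong A R"
| refl: "u \<in> lists A \<Longrightarrow> (u, u) \<in> pres_cong A R"
| sym: "(u, v) \<in> pres_cong A R \<Longrightarrow> (v, u) \<in> pres_cong A R"
| trans: "(u, v) \<in> pres_cong A R \<Longrightarrow> (v, w) \<in> pres_cong A R \<Longrightarrow> (u, w) \<in> pres_cong A R"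
| mult: "(u, v) \<in> pres_cong A R \<Longrightarrow> (u', v') \<in> pres_cong A R \<Longrightarrow>
         (u @ u', v @ v') \<in> pres_cong A R"

definition word_class :: "'a set \<Rightarrow> ('a list \<times> 'a list) set \<Rightarrow> 'a list \<Rightarrow> 'a list set" where
  "word_class A R w = pres_cong A R `` {w}"

definition presented_monoid :: "'a set \<Rightarrow> ('a list \<times> 'a list) set \<Rightarrow> 'a list set monoid" where
  "presented_monoid A R =
     \<lparr>carrier = lists A // pres_cong A R,
      mult = (\<lambda>X Y. \<Union>u\<in>X. \<Union>v\<in>Y. word_class A R (u @ v)),
      one = word_class A R []\<rparr>"

lemma pres_cong_lists: "(u, v) \<in> pres_cong A R \<Longrightarrow> u \<in> lists A \<and> v \<in> lists A"
  by (induction rule: pres_cong.induct) auto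

lemma equiv_pres_cong: "equiv (lists A) (pres_cong A R)"
proof (rule equivI)
  show "pres_cong A R \<subseteq> lists A \<times> lists A"
    using pres_cong_lists by fast
  show "refl_on (lists A) (pres_cong A R)"
    by (meson pres_cong.refl refl_onI)
  show "sym (pres_cong A R)"
    by (meson pres_cong.sym symI)
  show "trans (pres_cong A R)"
    by (meson pres_cong.trans transI)
qed

lemma word_class_eq_iff:
  assumes "u \<in> lists A" "v \<in> lists A"
  shows "word_class A R u = word_class A R v \<longleftrightarrow> (u, v) \<in> pres_cong A R"
  unfolding word_class_def by (rule eq_equiv_class_iff[OF equiv_pres_cong assms])

lemma carrier_presented_monoid:
  "carrier (presented_monoid A R) = word_class A R ` lists A"
  by (auto simp: presented_monoid_def word_class_def quotient_def)

lemma mult_presented_monoid: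
  assumes "u \<in> lists A" "v \<in> lists A"
  shows "word_class A R u \<otimes>\<^bsub>presented_monoid A R\<^esub> word_class A R v = word_class A R (u @ v)"
proof -
  have "word_class A R (u' @ v') = word_class A R (u @ v)"
    if "u' \<in> word_class A R u" "v' \<in> word_class A R v" for u' v'
  proof -
    have "(u, u') \<in> pres_cong A R" "(v, v') \<in> pres_cong A R"
      using that by (auto simp: word_class_def)
    then have "(u @ v, u' @ v') \<in> pres_cong A R"
      by (rule pres_cong.mult)
    then show ?thesis
      unfolding word_class_def by (rule equiv_class_eq[OF equiv_pres_cong, symmetric])
  qed
  moreover have "u \<in> word_class A R u" "v \<in> word_class A R v"
    unfolding word_class_def using assms by (blast intro: pres_cong.refl)+
  ultimately have "(\<Union>u'\<in>word_class A R u. \<Union>v'\<in>word_class A R v. word_class A R (u' @ v'))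
      = word_class A R (u @ v)"
    by blast
  then show ?thesis
    by (simp add: presented_monoid_def)
qed

lemma one_presented_monoid: "\<one>\<^bsub>presented_monoid A R\<^esub> = word_class A R []"
  by (simp add: presented_monoid_def)

lemma monoid_presented_monoid: "monoid (presented_monoid A R)"
proof -
  let ?M = "presented_monoid A R"
  have words: "\<exists>u\<in>lists A. x = word_class A R u" if "x \<in> carrier ?M" for x
    using that unfolding carrier_presented_monoid by blast
  show ?thesis
  proof (rule monoidI)
    fix x y
    assume "x \<in> carrier ?M" "y \<in> carrier ?M"
    with words obtain u v where *: "u \<in> lists A" "v \<in> lists A"
      "x = word_class A R u" "y = word_class A R v"
      by meson
    have "u @ v \<in> lists A"
      using *(1,2) by simp
    then show "x \<otimes>\<^bsub>?M\<^esub> y \<in> carrier ?M"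
      unfolding *(3,4) mult_presented_monoid[OF *(1,2)] carrier_presented_monoid by blast
  next
    show "\<one>\<^bsub>?M\<^esub> \<in> carrier ?M"
      unfolding one_presented_monoid carrier_presented_monoid by blast
  next
    fix x y z
    assume "x \<in> carrier ?M" "y \<in> carrier ?M" "z \<in> carrier ?M"
    with words obtain u v w where *: "u \<in> lists A" "v \<in> lists A" "w \<in> lists A"
      "x = word_class A R u" "y = word_class A R v" "z = word_class A R w"
      by meson
    have "u @ v \<in> lists A" "v @ w \<in> lists A"
      using *(1-3) by simp_all
    then show "x \<otimes>\<^bsub>?M\<^esub> y \<otimes>\<^bsub>?M\<^esub> z = x \<otimes>\<^bsub>?M\<^esub> (y \<otimes>\<^bsub>?M\<^esub> z)"
      unfolding *(4-6) by (simp only: mult_presented_monoid *(1-3) append_assoc)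
  next
    fix x
    assume "x \<in> carrier ?M"
    with words obtain u where *: "u \<in> lists A" "x = word_class A R u"
      by meson
    show "\<one>\<^bsub>?M\<^esub> \<otimes>\<^bsub>?M\<^esub> x = x"
      unfolding *(2) one_presented_monoid
      by (simp only: mult_presented_monoid[OF lists.Nil *(1)] append_Nil)
    show "x \<otimes>\<^bsub>?M\<^esub> \<one>\<^bsub>?M\<^esub> = x"
      unfolding *(2) one_presented_monoid
      by (simp only: mult_presented_monoid[OF *(1) lists.Nil] append_Nil2)
  qed
qed

datatype point = Unprimed nat | Primed nat

definition points :: "nat \<Rightarrow> point set" where
  "points n = Unprimed ` {1..n} \<union> Primed ` {1..n}"

text \<open>The product is computed on three rows. The left factor occupies the left and middle
  rows, the right factor the middle and right rows.\<close>

datatype point3 = LeftRow nat | MiddleRow nat | RightRow nat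

definition points3 :: "nat \<Rightarrow> point3 set" where
  "points3 n = LeftRow ` {1..n} \<union> MiddleRow ` {1..n} \<union> RightRow ` {1..n}"

fun left_factor :: "point \<Rightarrow> point3" where
  "left_factor (Unprimed i) = LeftRow i"
| "left_factor (Primed i) = MiddleRow i"

fun right_factor :: "point \<Rightarrow> point3" where
  "right_factor (Unprimed i) = MiddleRow i"
| "right_factor (Primed i) = RightRow i"

fun outer :: "point \<Rightarrow> point3" where
  "outer (Unprimed i) = LeftRow i"
| "outer (Primed i) = RightRow i"

definition block_rel :: "'a set set \<Rightarrow> ('a \<times> 'a) set" where
  "block_rel \<alpha> = {(x, y). \<exists>B\<in>\<alpha>. x \<in> B \<and> y \<in> B}"

definition glue :: "nat \<Rightarrow> point set set \<Rightarrow> point set set \<Rightarrow> (point3 \<times> point3) set" where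
  "glue n \<alpha> \<beta> =
     \<Inter>{E. equiv (points3 n) E \<and>
         map_prod left_factor left_factor ` block_rel \<alpha> \<subseteq> E \<and>
         map_prod right_factor right_factor ` block_rel \<beta> \<subseteq> E}"

definition part_mult :: "nat \<Rightarrow> point set set \<Rightarrow> point set set \<Rightarrow> point set set" where
  "part_mult n \<alpha> \<beta> =
     points n // {(x, y). x \<in> points n \<and> y \<in> points n \<and> (outer x, outer y) \<in> glue n \<alpha> \<beta>}"

definition partition_monoid :: "nat \<Rightarrow> point set set monoid" where
  "partition_monoid n =
     \<lparr>carrier = {\<alpha>. partition_on (points n) \<alpha>},
      mult = part_mult n,
      one = {{Unprimed j, Primed j} |j. j \<in> {1..n}}\<rparr>"

definition partial_brauer_monoid :: "nat \<Rightarrow> point set set monoid" where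
  "partial_brauer_monoid n =
     (partition_monoid n)
       \<lparr>carrier := {\<alpha> \<in> carrier (partition_monoid n). \<forall>B\<in>\<alpha>. card B \<le> 2}\<rparr>"

definition s_part :: "nat \<Rightarrow> nat \<Rightarrow> point set set" where
  "s_part n i =
     {{Unprimed i, Primed (i + 1)}, {Unprimed (i + 1), Primed i}} \<union>
     {{Unprimed j, Primed j} |j. j \<in> {1..n} \<and> j \<noteq> i \<and> j \<noteq> i + 1}"

definition pi_part :: "nat \<Rightarrow> nat \<Rightarrow> point set set" where
  "pi_part n i =
     {{Unprimed i, Unprimed (i + 1)}, {Primed i, Primed (i + 1)}} \<union>
     {{Unprimed j, Primed j} |j. j \<in> {1..n} \<and> j \<noteq> i \<and> j \<noteq> i + 1}"

definition varsigma_part :: "nat \<Rightarrow> nat \<Rightarrow> point set set" where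
  "varsigma_part n i =
     {{Unprimed i}, {Primed i}} \<union>
     {{Unprimed j, Primed j} |j. j \<in> {1..n} \<and> j \<noteq> i}"

datatype gen = \<sigma> nat | \<theta> nat | var\<theta> nat

definition PB_gens :: "nat \<Rightarrow> gen set" where
  "PB_gens n = \<sigma> ` {1..<n} \<union> \<theta> ` {1..<n} \<union> var\<theta> ` {1..n}"

inductive_set PB_rels :: "nat \<Rightarrow> (gen list \<times> gen list) set" for n where
  sigma_sq: "([\<sigma> i, \<sigma> i], []) \<in> PB_rels n"
    if "i \<in> {1..<n}"
| sigma_comm: "([\<sigma> i, \<sigma> j], [\<sigma> j, \<sigma> i]) \<in> PB_rels n"
    if "i \<in> {1..<n}" "j \<in> {1..<n}" "\<bar>int i - int j\<bar> > 1"
| sigma_braid: "([\<sigma> i, \<sigma> j, \<sigma> i], [\<sigma> j, \<sigma> i, \<sigma> j]) \<in> PB_rels n"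
    if "i \<in> {1..<n}" "j \<in> {1..<n}" "\<bar>int i - int j\<bar> = 1"
| theta_idem: "([\<theta> i, \<theta> i], [\<theta> i]) \<in> PB_rels n"
    if "i \<in> {1..<n}"
| theta_comm: "([\<theta> i, \<theta> j], [\<theta> j, \<theta> i]) \<in> PB_rels n"
    if "i \<in> {1..<n}" "j \<in> {1..<n}" "\<bar>int i - int j\<bar> > 1"
| theta_theta_theta: "([\<theta> i, \<theta> j, \<theta> i], [\<theta> i]) \<in> PB_rels n"
    if "i \<in> {1..<n}" "j \<in> {1..<n}" "\<bar>int i - int j\<bar> = 1"
| theta_sigma: "([\<theta> i, \<sigma> i], [\<theta> i]) \<in> PB_rels n"
    if "i \<in> {1..<n}"
| sigma_theta: "([\<sigma> i, \<theta> i], [\<theta> i]) \<in> PB_rels n"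
    if "i \<in> {1..<n}"
| theta_sigma_comm: "([\<theta> i, \<sigma> j], [\<sigma> j, \<theta> i]) \<in> PB_rels n"
    if "i \<in> {1..<n}" "j \<in> {1..<n}" "\<bar>int i - int j\<bar> > 1"
| sigma_theta_theta: "([\<sigma> i, \<theta> j, \<theta> i], [\<sigma> j, \<theta> i]) \<in> PB_rels n"
    if "i \<in> {1..<n}" "j \<in> {1..<n}" "\<bar>int i - int j\<bar> = 1"
| theta_theta_sigma: "([\<theta> i, \<theta> j, \<sigma> i], [\<theta> i, \<sigma> j]) \<in> PB_rels n"
    if "i \<in> {1..<n}" "j \<in> {1..<n}" "\<bar>int i - int j\<bar> = 1"
| vartheta_idem: "([var\<theta> i, var\<theta> i], [var\<theta> i]) \<in> PB_rels n"
    if "i \<in> {1..n}"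
| vartheta_comm: "([var\<theta> i, var\<theta> j], [var\<theta> j, var\<theta> i]) \<in> PB_rels n"
    if "i \<in> {1..n}" "j \<in> {1..n}" "i \<noteq> j"
| sigma_vartheta: "([\<sigma> i, var\<theta> i], [var\<theta> (i + 1), \<sigma> i]) \<in> PB_rels n"
    if "i \<in> {1..<n}"
| sigma_vartheta_comm: "([\<sigma> i, var\<theta> j], [var\<theta> j, \<sigma> i]) \<in> PB_rels n"
    if "i \<in> {1..<n}" "j \<in> {1..n}" "j \<noteq> i" "j \<noteq> i + 1"
| vartheta_sigma_vartheta: "([var\<theta> i, \<sigma> i, var\<theta> i], [var\<theta> i, var\<theta> (i + 1)]) \<in> PB_rels n"
    if "i \<in> {1..<n}"
| theta_vartheta_comm: "([\<theta> i, var\<theta> j], [var\<theta> j, \<theta> i]) \<in> PB_rels n"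
    if "i \<in> {1..<n}" "j \<in> {1..n}" "j \<noteq> i" "j \<noteq> i + 1"
| theta_vartheta_Suc: "([\<theta> i, var\<theta> i], [\<theta> i, var\<theta> (i + 1)]) \<in> PB_rels n"
    if "i \<in> {1..<n}"
| theta_vartheta_both: "([\<theta> i, var\<theta> (i + 1)], [\<theta> i, var\<theta> i, var\<theta> (i + 1)]) \<in> PB_rels n"
    if "i \<in> {1..<n}"
| vartheta_theta_Suc: "([var\<theta> i, \<theta> i], [var\<theta> (i + 1), \<theta> i]) \<in> PB_rels n"
    if "i \<in> {1..<n}"
| vartheta_theta_both: "([var\<theta> (i + 1), \<theta> i], [var\<theta> i, var\<theta> (i + 1), \<theta> i]) \<in> PB_rels n"
    if "i \<in> {1..<n}"
| theta_vartheta_theta: "([\<theta> i, var\<theta> i, \<theta> i], [\<theta> i]) \<in> PB_rels n"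
    if "i \<in> {1..<n}"
| vartheta_theta_vartheta: "([var\<theta> i, \<theta> i, var\<theta> i], [var\<theta> i, var\<theta> (i + 1)]) \<in> PB_rels n"
    if "i \<in> {1..<n}"

abbreviation T_monoid :: "nat \<Rightarrow> gen list set monoid" where
  "T_monoid n \<equiv> presented_monoid (PB_gens n) (PB_rels n)"

abbreviation T_gen :: "nat \<Rightarrow> gen \<Rightarrow> gen list set" where
  "T_gen n g \<equiv> word_class (PB_gens n) (PB_rels n) [g]"

end

theory Submission
  imports Defs "HOL-Combinatorics.Permutations"
begin

text \<open>
  In any monoid satisfying the relations, the \<open>\<sigma>\<^sub>i\<close> give a homomorphism \<open>h\<close> from the symmetric group
  (Coxeter), and conjugating \<open>\<theta>\<^sub>1\<close> by it yields elements \<open>\<theta>\<^bsub>a,b\<^esub>\<close> for all \<open>a \<noteq> b\<close>. The relations give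
  \<open>\<theta>\<^bsub>a,b\<^esub> = \<theta>\<^bsub>a,b\<^esub> \<vartheta>\<^sub>a \<vartheta>\<^sub>b \<theta>\<^bsub>a,b\<^esub>\<close>, so upper and lower blocks of size two need not be matched with each other:
  every element equals \<open>\<Theta>\<^sub>u \<vartheta>\<^sub>C h(p) \<Theta>\<^sub>v\<close>, where \<open>u\<close> and \<open>v\<close> are matchings, \<open>u\<close> lives on \<open>C\<close> and \<open>v\<close> on \<open>p(C)\<close>.
  This form is preserved by right multiplication with generators, and it depends on \<open>p\<close> only outside
  \<open>C\<close>, i.e. exactly on the partition with upper pairs \<open>u\<close>, lower pairs \<open>v\<close> and transversals
  \<open>{j, p(j)'}\<close> for \<open>j \<notin> C\<close>.

  On the side of partitions, \<open>\<alpha>\<close> is encoded by the relation between \<open>{0,1}\<close>-labellings of the two rows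
  that are jointly constant on the blocks of \<open>\<alpha>\<close>. This encoding is injective and turns the product of
  partitions into composition of relations.
\<close>

section \<open>Permutations of an interval\<close>

text \<open>The partition of a word is not found by multiplying partitions. Two facts meet instead:
  \<open>word_rel\<close> respects the relations, and each normal form is the value of some word
  whose relation is that of an explicit partition. A word thus has the relation of the partition of
  its normal form, and words with equal relations have equal normal forms. Injectivity and
  surjectivity follow without counting either monoid. The critical product is a hook that meets two
  strands of the permutation. Its factorization through two \<vartheta>'s lets one copy rise through
  the permutation and join the upper matching, while the other stays below; the \<vartheta>'s
  between them record the two lost strands. The strands are carried by a full permutation rather
  than a partial bijection, so that the homomorphism \<open>h\<close> applies. Its arbitrary values
  on \<open>C\<close> do no harm: \<vartheta>'s on two points absorb the transposition of these
  points, hence \<vartheta>'s on \<open>C\<close> absorb all permutations of \<open>C\<close>. Two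
  labels suffice to see a partition, because the indicator function of a block is a labelling
  constant on all blocks.\<close>

unbundle no m_inv_syntax

text \<open>Injectivity turns the weak inequalities into strict ones, so \<open>i \<le> p i\<close>
  propagates upwards from \<open>k\<close>; a permutation that lowers no point is the
  identity.\<close>

lemma permutes_ascent_free:
  assumes p: "p permutes {k..n::nat}" and "\<And>i. i \<in> {k..<n} \<Longrightarrow> p i \<le> p (Suc i)"
  shows "p = id"
proof -
  have "i \<le> p i" if "i \<in> {k..n}" for i
  proof -
    have "k \<le> i" "i \<le> n" using that by auto
    then show ?thesis
    proof (induction i rule: dec_induct)
      case base
      then show ?case using permutes_in_image[OF p, of k] that by simp
    next
      case (step j)
      moreover have "p j \<noteq> p (Suc j)"
        using permutes_inj[OF p] by (metis injD n_not_Suc_n)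
      ultimately show ?case using assms(2)[of j] by simp
    qed
  qed
  with p show ?thesis by (meson permutes_natset_ge)
qed

text \<open>The swap exchanges two summands whose coefficients differ by one, so the sum drops by
  exactly \<open>p i - p (Suc i)\<close>. Unlike a count of inversions, this measure changes in two
  summands only.\<close>

lemma descent_measure:
  fixes p :: "nat \<Rightarrow> nat"
  assumes "i \<in> {1..<n}" "p (Suc i) < p i"
  shows "(\<Sum>j\<in>{1..n}. (n - j) * (p \<circ> transpose i (Suc i)) j) < (\<Sum>j\<in>{1..n}. (n - j) * p j)"
proof -
  define D where "D = {1..n} - {i} - {Suc i}"
  have split: "(\<Sum>j\<in>{1..n}. f j) = f i + (f (Suc i) + (\<Sum>j\<in>D. f j))" for f :: "nat \<Rightarrow> nat"
    unfolding D_def using assms(1) by (subst sum.remove[of _ i], simp, simp, subst sum.remove[of _ "Suc i"]) auto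
  have eq: "(\<Sum>j\<in>D. (n - j) * (p \<circ> transpose i (Suc i)) j) = (\<Sum>j\<in>D. (n - j) * p j)"
    by (rule sum.cong) (auto simp: D_def)
  obtain k where "n - i = Suc k" "n - Suc i = k"
    using assms(1) by (metis Suc_diff_Suc atLeastLessThan_iff)
  then show ?thesis
    unfolding split eq using assms(2) by (simp add: algebra_simps)
qed

lemma permutes_transpose_comp:
  assumes "p permutes S" "i \<in> S" "j \<in> S"
  shows "p \<circ> transpose i j permutes S"
  by (rule permutes_compose[OF permutes_swap_id[OF assms(2,3)] assms(1)])

text \<open>Bubble sort as an induction rule. The lower end \<open>k\<close> is variable because the
  permutations of \<open>{3..n}\<close>, which fix 1 and 2, are treated in the same way as those of
  \<open>{1..n}\<close>.\<close>

lemma permutes_adjacent_induct [consumes 1, case_names id comp]: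
  assumes p: "p permutes {k..n::nat}" and "P id"
    and step: "\<And>q i. q permutes {k..n} \<Longrightarrow> k \<le> i \<Longrightarrow> i < n \<Longrightarrow> P q \<Longrightarrow> P (q \<circ> transpose i (Suc i))"
    and k: "1 \<le> k"
  shows "P p"
  using p
proof (induction "\<Sum>j\<in>{1..n}. (n - j) * p j" arbitrary: p rule: less_induct)
  case less
  show ?case
  proof (cases "\<exists>i\<in>{k..<n}. p (Suc i) < p i")
    case True
    then obtain i where i: "i \<in> {k..<n}" "p (Suc i) < p i" by blast
    let ?q = "p \<circ> transpose i (Suc i)"
    have "?q permutes {k..n}"
      using less.prems i(1) by (intro permutes_transpose_comp) auto
    moreover from this have "P ?q"
      using i k by (intro less.hyps descent_measure) auto
    ultimately have "P (?q \<circ> transpose i (Suc i))"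
      using i(1) step by simp
    then show ?thesis by (simp add: comp_assoc)
  next
    case False
    then have "p = id" using permutes_ascent_free[OF less.prems] by force
    then show ?thesis using assms(2) by simp
  qed
qed

text \<open>The complements of \<open>A\<close> and of its image have equally many points, and any
  bijection between them completes \<open>f\<close>. This moves small index tuples to arbitrary ones
  and later completes the strands of a partition to a permutation.\<close>

lemma ex_permutes_extending:
  assumes "finite S" "A \<subseteq> S" "f ` A \<subseteq> S" "inj_on f A"
  shows "\<exists>q. q permutes S \<and> (\<forall>x\<in>A. q x = f x)"
proof -
  have "card (S - A) = card (S - f ` A)"
    using assms by (simp add: card_Diff_subset card_image finite_subset)
  then obtain g where g: "bij_betw g (S - A) (S - f ` A)"
    using assms(1) by (metis bij_betw_iff_card finite_Diff)
  let ?q = "\<lambda>x. if x \<in> A then f x else if x \<in> S then g x else x"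
  have 1: "bij_betw ?q A (f ` A)"
    using assms(4) by (subst bij_betw_cong[of A _ f]) (auto simp: bij_betw_def)
  have 2: "bij_betw ?q (S - A) (S - f ` A)"
    using g by (subst bij_betw_cong[of _ _ g]) auto
  have "bij_betw ?q (A \<union> (S - A)) (f ` A \<union> (S - f ` A))"
    by (rule bij_betw_combine[OF 1 2]) auto
  then have "bij_betw ?q S S"
    using assms(2,3) by (simp add: Un_Diff_cancel Un_absorb1)
  then have "?q permutes S" using assms(2) by (intro bij_imp_permutes) auto
  then show ?thesis by (intro exI[of _ ?q]) auto
qed

section \<open>Normal forms in monoids satisfying the relations\<close>


definition cprod :: "('b \<Rightarrow> 'm::monoid_mult) \<Rightarrow> 'b set \<Rightarrow> 'm" where
  "cprod f A = Finite_Set.fold (\<lambda>x y. f x * y) 1 A"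

definition pairwise_commuting :: "('b \<Rightarrow> 'm::monoid_mult) \<Rightarrow> 'b set \<Rightarrow> bool" where
  "pairwise_commuting f A \<longleftrightarrow> (\<forall>a\<in>A. \<forall>b\<in>A. f a * f b = f b * f a)"

lemma pairwise_commuting_subset: "pairwise_commuting f A \<Longrightarrow> B \<subseteq> A \<Longrightarrow> pairwise_commuting f B"
  unfolding pairwise_commuting_def by blast

lemma cprod_empty [simp]: "cprod f {} = 1"
  by (simp add: cprod_def)

text \<open>Left commutativity of the folded function is commutation of the factors; it is available
  on \<open>insert x A\<close> only, hence the relativized locale
  \<open>comp_fun_commute_on\<close>.\<close>

lemma cprod_insert:
  assumes "finite A" "x \<notin> A" "pairwise_commuting f (insert x A)"
  shows "cprod f (insert x A) = f x * cprod f A"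
proof -
  interpret comp_fun_commute_on "insert x A" "\<lambda>x y. f x * y"
    by standard (use assms(3) in \<open>auto simp: pairwise_commuting_def fun_eq_iff mult.assoc[symmetric]\<close>)
  show ?thesis
    unfolding cprod_def using assms by (simp add: fold_insert)
qed

text \<open>The element \<open>y\<close> passes the factors one by one and renames each index by
  \<open>r\<close>. With \<open>y\<close> the element of a permutation, this carries a whole
  matching through the permutation.\<close>

lemma cprod_intertwine:
  assumes "finite A" "inj_on r A" "pairwise_commuting f A" "pairwise_commuting g (r ` A)"
    and "\<And>a. a \<in> A \<Longrightarrow> f a * y = y * g (r a)"
  shows "cprod f A * y = y * cprod g (r ` A)"
  using assms
proof (induction A rule: finite_induct)
  case (insert x A)
  have "pairwise_commuting f A" "pairwise_commuting g (r ` A)"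
    using insert.prems(2,3) by (auto intro: pairwise_commuting_subset)
  then have IH: "cprod f A * y = y * cprod g (r ` A)"
    using insert by auto
  have "cprod f (insert x A) * y = f x * (cprod f A * y)"
    using insert by (simp add: cprod_insert mult.assoc)
  also have "\<dots> = y * (g (r x) * cprod g (r ` A))"
    using insert.prems(4)[of x] by (simp add: IH mult.assoc[symmetric])
  also have "g (r x) * cprod g (r ` A) = cprod g (r ` insert x A)"
    using insert by (subst image_insert, subst cprod_insert) auto
  finally show ?case .
qed simp

lemma cprod_commute:
  assumes "finite A" "pairwise_commuting f A" "\<And>a. a \<in> A \<Longrightarrow> f a * y = y * f a"
  shows "cprod f A * y = y * cprod f A"
  using cprod_intertwine[of A id f f y] assms by simp

declare One_nat_def [simp del]

text \<open>An arbitrary model of the relations on a type-class monoid, so that calculations can be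
  done by plain rewriting. It is instantiated later with the right multiplications of the presented
  monoid.\<close>

locale PB_rep =
  fixes n :: nat and val :: "gen \<Rightarrow> 'm::monoid_mult"
  assumes rels: "(u, v) \<in> PB_rels n \<Longrightarrow> prod_list (map val u) = prod_list (map val v)"
begin

abbreviation s :: "nat \<Rightarrow> 'm" where "s i \<equiv> val (\<sigma> i)"
abbreviation t :: "nat \<Rightarrow> 'm" where "t i \<equiv> val (\<theta> i)"
abbreviation e :: "nat \<Rightarrow> 'm" where "e i \<equiv> val (var\<theta> i)"

lemma s_sq: "i \<in> {1..<n} \<Longrightarrow> s i * s i = 1"
  using rels[OF sigma_sq] by simp

lemma s_sq': "i \<in> {1..<n} \<Longrightarrow> s i * (s i * x) = x"
  using s_sq[of i] by (simp flip: mult.assoc)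

lemma s_comm: "i \<in> {1..<n} \<Longrightarrow> j \<in> {1..<n} \<Longrightarrow> \<bar>int i - int j\<bar> > 1 \<Longrightarrow> s i * s j = s j * s i"
  using rels[OF sigma_comm] by simp

lemma s_braid: "i \<in> {1..<n} \<Longrightarrow> Suc i \<in> {1..<n} \<Longrightarrow> s i * (s (Suc i) * s i) = s (Suc i) * (s i * s (Suc i))"
  using rels[OF sigma_braid[of i n "Suc i"]] by simp

text \<open>The relation for index \<open>i\<close> yields the one for \<open>Suc i\<close> by
  multiplying with the involution \<open>s i\<close> on both sides; writing the new index with
  \<open>transpose\<close> merges all cases of (6) that move a \<vartheta> past a \<sigma>.\<close>

lemma e_s:
  assumes "i \<in> {1..<n}" "a \<in> {1..n}"
  shows "e a * s i = s i * e (transpose i (Suc i) a)"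
proof -
  have "s i * e i = e (Suc i) * s i"
    using rels[OF sigma_vartheta[OF assms(1)]] by (simp add: One_nat_def)
  moreover from this have "e i * s i = s i * e (Suc i)"
    using s_sq[OF assms(1)] s_sq'[OF assms(1)] by (metis mult.assoc mult_1_right)
  moreover have "s i * e a = e a * s i" if "a \<noteq> i" "a \<noteq> Suc i"
    using rels[OF sigma_vartheta_comm[OF assms]] that by simp
  ultimately show ?thesis
    by (cases "a = i"; cases "a = Suc i") auto
qed

text \<open>
  The element of a permutation is defined by multiplying generators along an arbitrary choice of
  descents. By \<open>h_descent\<close> the choice is immaterial, as in Matsumoto's theorem: two descents are
  reconciled by commuting or by the braid relation. Since the monoid acts on the right,
  \<open>h p * h q = h (q \<circ> p)\<close>.
\<close>

definition descent :: "(nat \<Rightarrow> nat) \<Rightarrow> nat \<Rightarrow> bool" where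
  "descent p i \<longleftrightarrow> i \<in> {1..<n} \<and> p (Suc i) < p i"

definition weight :: "(nat \<Rightarrow> nat) \<Rightarrow> nat" where
  "weight p = (\<Sum>j\<in>{1..n}. (n - j) * p j)"

lemma weight_descent: "descent p i \<Longrightarrow> weight (p \<circ> transpose i (Suc i)) < weight p"
  unfolding weight_def descent_def using descent_measure by blast

function h :: "(nat \<Rightarrow> nat) \<Rightarrow> 'm" where
  "h p = (if \<exists>i. descent p i
          then s (SOME i. descent p i) *
            h (p \<circ> transpose (SOME i. descent p i) (Suc (SOME i. descent p i)))
          else 1)"
  by auto
termination
  by (relation "measure weight") (auto intro!: weight_descent intro: someI)

declare h.simps [simp del]

lemma h_descent: "descent p i \<Longrightarrow> h p = s i * h (p \<circ> transpose i (Suc i))"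
proof (induction "weight p" arbitrary: p i rule: less_induct)
  case less
  let ?tr = "\<lambda>i. transpose i (Suc i)"
  \<comment> \<open>The slot \<open>x\<close> is filled with \<open>id\<close> after one swap and
    with a second adjacent transposition after two; in both cases the weight stays below that of
    \<open>p\<close>.\<close>
  have IH: "h (p \<circ> ?tr k \<circ> x) = s l * h (p \<circ> ?tr k \<circ> x \<circ> ?tr l)"
    if "descent p k" "weight (p \<circ> ?tr k \<circ> x) \<le> weight (p \<circ> ?tr k)" "descent (p \<circ> ?tr k \<circ> x) l" for k l x
    using less.hyps[of "p \<circ> ?tr k \<circ> x" l] weight_descent[OF that(1)] that by simp
  have IH1: "h (p \<circ> ?tr k) = s l * h (p \<circ> ?tr k \<circ> ?tr l)"
    if "descent p k" "descent (p \<circ> ?tr k) l" for k l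
    using IH[of k id l] that by simp
  have IH2: "h (p \<circ> ?tr k \<circ> ?tr l) = s m * h (p \<circ> ?tr k \<circ> ?tr l \<circ> ?tr m)"
    if "descent p k" "descent (p \<circ> ?tr k) l" "descent (p \<circ> ?tr k \<circ> ?tr l) m" for k l m
    using IH[of k "?tr l" m] that weight_descent[OF that(2)] by simp
  have braid: "s a * h (p \<circ> ?tr a) = s (Suc a) * h (p \<circ> ?tr (Suc a))"
    if d: "descent p a" "descent p (Suc a)" for a
  proof -
    have r: "a \<in> {1..<n}" "Suc a \<in> {1..<n}" and v: "p (Suc (Suc a)) < p (Suc a)" "p (Suc a) < p a"
      using d by (auto simp: descent_def)
    \<comment> \<open>Two neighbouring descents mean three decreasing values. Sorting them takes
      three swaps, starting at either descent, and these are the two sides of the braid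
      relation.\<close>
    have d1: "descent (p \<circ> ?tr a) (Suc a)" "descent (p \<circ> ?tr (Suc a)) a"
      "descent (p \<circ> ?tr a \<circ> ?tr (Suc a)) a" "descent (p \<circ> ?tr (Suc a) \<circ> ?tr a) (Suc a)"
      using r v by (auto simp: descent_def transpose_def)
    have eq: "p \<circ> ?tr a \<circ> ?tr (Suc a) \<circ> ?tr a = p \<circ> ?tr (Suc a) \<circ> ?tr a \<circ> ?tr (Suc a)"
      by (auto simp: fun_eq_iff transpose_def)
    have "s a * h (p \<circ> ?tr a) = s a * (s (Suc a) * (s a * h (p \<circ> ?tr a \<circ> ?tr (Suc a) \<circ> ?tr a)))"
      using IH1[OF d(1) d1(1)] IH2[OF d(1) d1(1) d1(3)] by simp
    also have "\<dots> = s (Suc a) * (s a * (s (Suc a) * h (p \<circ> ?tr (Suc a) \<circ> ?tr a \<circ> ?tr (Suc a))))"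
      using s_braid[OF r] unfolding eq by (simp flip: mult.assoc)
    also have "\<dots> = s (Suc a) * h (p \<circ> ?tr (Suc a))"
      using IH1[OF d(2) d1(2)] IH2[OF d(2) d1(2) d1(4)] by simp
    finally show ?thesis .
  qed
  define j where "j = (SOME i. descent p i)"
  have j: "descent p j"
    unfolding j_def using less.prems by (rule someI)
  have hj: "h p = s j * h (p \<circ> ?tr j)"
    using less.prems unfolding j_def by (subst h.simps) auto
  consider "i = j" | "j = Suc i" | "i = Suc j" | "\<bar>int i - int j\<bar> > 1"
    by linarith
  then show ?case
  proof cases
    case 1
    then show ?thesis using hj by simp
  next
    case 2
    then show ?thesis using braid[of i] less.prems j hj by simp
  next
    case 3
    then show ?thesis using braid[of j] less.prems j hj by simp
  next
    case 4
    have r: "i \<in> {1..<n}" "j \<in> {1..<n}"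
      using j less.prems by (auto simp: descent_def)
    have d: "descent (p \<circ> ?tr j) i" "descent (p \<circ> ?tr i) j"
      using 4 j less.prems by (auto simp: descent_def transpose_def)
    have eq: "p \<circ> ?tr j \<circ> ?tr i = p \<circ> ?tr i \<circ> ?tr j"
      using 4 by (auto simp: fun_eq_iff transpose_def)
    have "h p = s j * (s i * h (p \<circ> ?tr i \<circ> ?tr j))"
      using hj IH1[OF j d(1)] eq by simp
    also have "\<dots> = s i * (s j * h (p \<circ> ?tr i \<circ> ?tr j))"
      using s_comm[OF r 4] by (simp flip: mult.assoc)
    also have "\<dots> = s i * h (p \<circ> ?tr i)"
      using IH1[OF less.prems d(2)] by simp
    finally show ?thesis .
  qed
qed

abbreviation perm :: "(nat \<Rightarrow> nat) \<Rightarrow> bool" where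
  "perm p \<equiv> p permutes {1..n}"

lemma h_adjacent:
  assumes p: "perm p" and i: "i \<in> {1..<n}"
  shows "h (p \<circ> transpose i (Suc i)) = s i * h p"
proof (cases "descent p i")
  case True
  then show ?thesis using h_descent[OF True] s_sq'[OF i] by simp
next
  case False
  have "p i \<noteq> p (Suc i)"
    using permutes_inj[OF p] by (metis injD n_not_Suc_n)
  then have "descent (p \<circ> transpose i (Suc i)) i"
    using False i by (simp add: descent_def)
  then show ?thesis
    using h_descent by (fastforce simp: comp_assoc)
qed

lemma h_id: "h id = 1"
proof -
  have "\<not> descent id i" for i by (simp add: descent_def)
  then show ?thesis by (subst h.simps) auto
qed

lemma h_comp: "perm p \<Longrightarrow> perm q \<Longrightarrow> h p * h q = h (q \<circ> p)"
proof (induction p rule: permutes_adjacent_induct)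
  case id
  then show ?case by (simp add: h_id[unfolded id_def])
next
  case (comp p i)
  have i: "i \<in> {1..<n}" using comp by auto
  have "h (p \<circ> transpose i (Suc i)) * h q = s i * (h p * h q)"
    using h_adjacent[OF comp.hyps(1) i] by (simp add: mult.assoc)
  also have "\<dots> = h (q \<circ> p \<circ> transpose i (Suc i))"
    unfolding comp.IH[OF comp.prems]
    using h_adjacent[OF permutes_compose[OF comp.hyps(1) comp.prems] i] by simp
  finally show ?case by (simp only: comp_assoc)
qed simp

lemma h_inv: "perm p \<Longrightarrow> h p * h (inv p) = 1" "perm p \<Longrightarrow> h (inv p) * h p = 1"
  by (simp_all add: h_comp permutes_inv permutes_inv_o h_id)

lemma h_inv': "perm p \<Longrightarrow> h p * (h (inv p) * x) = x" "perm p \<Longrightarrow> h (inv p) * (h p * x) = x"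
  by (simp_all add: h_inv flip: mult.assoc)

lemma h_transpose_Suc: "i \<in> {1..<n} \<Longrightarrow> h (transpose i (Suc i)) = s i"
  using h_adjacent[OF permutes_id, of i] by (simp add: h_id)

lemma e_h: "perm q \<Longrightarrow> a \<in> {1..n} \<Longrightarrow> e a * h q = h q * e (q a)"
proof (induction q arbitrary: a rule: permutes_adjacent_induct)
  case id
  then show ?case by (simp add: h_id[unfolded id_def])
next
  case (comp q i)
  have i: "i \<in> {1..<n}" using comp by auto
  have *: "transpose i (Suc i) a \<in> {1..n}"
    using i comp.prems by (auto simp: transpose_def)
  have "e a * h (q \<circ> transpose i (Suc i)) = s i * (e (transpose i (Suc i) a) * h q)"
    using h_adjacent[OF comp.hyps(1) i] e_s[OF i comp.prems] by (simp flip: mult.assoc)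
  also have "\<dots> = h (q \<circ> transpose i (Suc i)) * e ((q \<circ> transpose i (Suc i)) a)"
    using h_adjacent[OF comp.hyps(1) i] comp.IH[OF *] by (simp add: mult.assoc)
  finally show ?case .
qed simp

section \<open>Conjugation by permutations and hooks at arbitrary places\<close>

definition conj :: "(nat \<Rightarrow> nat) \<Rightarrow> 'm \<Rightarrow> 'm" where
  "conj q x = h (inv q) * x * h q"

text \<open>Together with \<open>conj_comp\<close> this makes \<open>conj\<close> an action of the
  symmetric group by automorphisms. A relation proved for the indices 1, 2, 3, 4 is therefore
  carried to any tuple of distinct indices.\<close>

lemma conj_mult: "perm q \<Longrightarrow> conj q (x * y) = conj q x * conj q y"
  by (simp add: conj_def mult.assoc h_inv')

lemma conj_e: "perm q \<Longrightarrow> a \<in> {1..n} \<Longrightarrow> conj q (e a) = e (q a)"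
  by (simp add: conj_def mult.assoc e_h h_inv')

lemma conj_comp: "perm p \<Longrightarrow> perm q \<Longrightarrow> conj (q \<circ> p) x = conj q (conj p x)"
  by (simp add: conj_def mult.assoc permutes_inv_o permutes_inv
      o_inv_distrib[OF permutes_bij permutes_bij] flip: h_comp)

lemma conj_id [simp]: "conj id x = x"
  by (simp add: conj_def h_id)

lemma conj_eqI: "perm q \<Longrightarrow> x * h q = h q * y \<Longrightarrow> conj q x = y"
  by (simp add: conj_def mult.assoc h_inv')

lemma conj_h_transpose:
  assumes "perm q" "a \<in> {1..n}" "b \<in> {1..n}"
  shows "conj q (h (transpose a b)) = h (transpose (q a) (q b))"
proof (rule conj_eqI[OF assms(1)])
  have "q \<circ> transpose a b = transpose (q a) (q b) \<circ> q"
    using permutes_inj[OF assms(1)] by (auto simp: fun_eq_iff transpose_def dest: injD)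
  then show "h (transpose a b) * h q = h q * h (transpose (q a) (q b))"
    using assms permutes_swap_id[of "q a" "{1..n}" "q b"] permutes_in_image[OF assms(1)]
    by (simp add: h_comp permutes_swap_id)
qed

text \<open>A permutation of \<open>{3..n}\<close> is a product of adjacent transpositions with
  index at least 3, and those commute with \<open>t 1\<close> by (3). Consequently a conjugate of
  \<open>t 1\<close> can depend only on the images of 1 and 2.\<close>

lemma t_h_stabilizer:
  assumes "n \<ge> 2"
  shows "q permutes {3..n} \<Longrightarrow> t 1 * h q = h q * t 1"
proof (induction q rule: permutes_adjacent_induct)
  case id
  then show ?case by (simp add: h_id[unfolded id_def])
next
  case (comp q i)
  have i: "i \<in> {1..<n}" using comp by auto
  have q: "perm q" using comp.hyps(1) by (rule permutes_subset) auto
  have "t 1 * s i = s i * t 1"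
    using rels[OF theta_sigma_comm[of 1 n i]] comp(2,3) by simp
  then show ?case
    using comp.IH unfolding h_adjacent[OF q i] by (metis mult.assoc)
qed simp

definition th :: "nat \<Rightarrow> nat \<Rightarrow> 'm" where
  "th a b = conj (SOME q. perm q \<and> q 1 = a \<and> q 2 = b) (t 1)"

lemma conj_t1:
  assumes "n \<ge> 2" "perm q"
  shows "conj q (t 1) = th (q 1) (q 2)"
proof -
  define r where "r = (SOME r. perm r \<and> r 1 = q 1 \<and> r 2 = q 2)"
  have r: "perm r" "r 1 = q 1" "r 2 = q 2"
    using someI[of "\<lambda>r. perm r \<and> r 1 = q 1 \<and> r 2 = q 2" q] assms(2) unfolding r_def by auto
  \<comment> \<open>The permutations \<open>q\<close> and \<open>r\<close> agree at 1 and 2, so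
    \<open>u\<close> fixes both points, and conjugation by \<open>u\<close> does not change
    \<open>t 1\<close>.\<close>
  define u where "u = inv r \<circ> q"
  have u: "perm u"
    using r assms unfolding u_def by (intro permutes_compose permutes_inv)
  moreover have "u x = x" if "x \<in> {1..n} - {3..n}" for x
  proof -
    have "x = 1 \<or> x = 2" using that by auto
    then show ?thesis using r by (auto simp: u_def permutes_inv_eq)
  qed
  ultimately have "u permutes {3..n}" by (rule permutes_superset)
  then have "conj u (t 1) = t 1"
    using t_h_stabilizer assms(1) u by (intro conj_eqI) auto
  moreover have "q = r \<circ> u"
    using r(1) by (auto simp: u_def fun_eq_iff permutes_inverses)
  ultimately have "conj q (t 1) = conj r (t 1)"
    using r u by (simp add: conj_comp)
  then show ?thesis unfolding th_def r_def .
qed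

lemma ex_perm2:
  assumes "a \<in> {1..n}" "b \<in> {1..n}" "a \<noteq> b"
  obtains q where "perm q" "q 1 = a" "q 2 = b" "n \<ge> 2"
proof -
  have n: "n \<ge> 2" using assms by auto
  have "\<exists>q. perm q \<and> (\<forall>x\<in>{1,2}. q x = (if x = 1 then a else b))"
    using assms n by (intro ex_permutes_extending) (auto simp: inj_on_def)
  then show ?thesis using that n by auto
qed

lemma ex_perm3:
  assumes "a \<in> {1..n}" "b \<in> {1..n}" "c \<in> {1..n}" "distinct [a, b, c]"
  obtains q where "perm q" "q 1 = a" "q 2 = b" "q 3 = c" "n \<ge> 3"
proof -
  have "card {a, b, c} \<le> card {1..n}"
    using assms by (intro card_mono) auto
  then have n: "n \<ge> 3" using assms(4) by simp
  have "\<exists>q. perm q \<and> (\<forall>x\<in>{1,2,3}. q x = (if x = 1 then a else if x = 2 then b else c))"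
    using assms n by (intro ex_permutes_extending) (auto simp: inj_on_def)
  then show ?thesis using that n by auto
qed

lemma ex_perm4:
  assumes "a \<in> {1..n}" "b \<in> {1..n}" "c \<in> {1..n}" "d \<in> {1..n}" "distinct [a, b, c, d]"
  obtains q where "perm q" "q 1 = a" "q 2 = b" "q 3 = c" "q 4 = d" "n \<ge> 4"
proof -
  have "card {a, b, c, d} \<le> card {1..n}"
    using assms by (intro card_mono) auto
  then have n: "n \<ge> 4" using assms(5) by simp
  have "\<exists>q. perm q \<and> (\<forall>x\<in>{1,2,3,4}. q x = (if x = 1 then a else if x = 2 then b else if x = 3 then c else d))"
    using assms n by (intro ex_permutes_extending) (auto simp: inj_on_def)
  then show ?thesis using that n by auto
qed

lemma conj_th:
  assumes "perm q" "a \<in> {1..n}" "b \<in> {1..n}" "a \<noteq> b"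
  shows "conj q (th a b) = th (q a) (q b)"
proof -
  obtain r where r: "perm r" "r 1 = a" "r 2 = b" "n \<ge> 2"
    using ex_perm2 assms by metis
  then have "conj q (th a b) = conj (q \<circ> r) (t 1)"
    using assms by (simp add: conj_comp conj_t1)
  also have "\<dots> = th (q a) (q b)"
    using r assms(1) by (subst conj_t1) (auto intro: permutes_compose)
  finally show ?thesis .
qed

lemma th_h:
  assumes "perm q" "a \<in> {1..n}" "b \<in> {1..n}" "a \<noteq> b"
  shows "th a b * h q = h q * th (q a) (q b)"
  unfolding conj_th[OF assms, symmetric] conj_def mult.assoc h_inv'(1)[OF assms(1)] ..

lemma th_1_2: "n \<ge> 2 \<Longrightarrow> th 1 2 = t 1"
  using conj_t1[OF _ permutes_id] by simp

text \<open>Relation (4) lets \<theta>'s at neighbouring indices be exchanged for \<sigma>'s: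
  \<open>t i * t (Suc i)\<close> equals both \<open>s (Suc i) * s i * t (Suc i)\<close> and
  \<open>t i * s (Suc i) * s i\<close>. Hence consecutive hooks are conjugate.\<close>

lemma t_eq_th: "i \<in> {1..<n} \<Longrightarrow> t i = th i (Suc i)"
proof (induction i)
  case (Suc i)
  show ?case
  proof (cases "i = 0")
    case True
    then show ?thesis using th_1_2 Suc.prems by (simp add: numeral_2_eq_2 One_nat_def)
  next
    case False
    \<comment> \<open>This permutation sends \<open>i\<close> to \<open>Suc i\<close> and
      \<open>Suc i\<close> to \<open>Suc (Suc i)\<close>, so it shifts the hook by one
      place.\<close>
    let ?q = "transpose i (Suc i) \<circ> transpose (Suc i) (Suc (Suc i))"
    have i: "i \<in> {1..<n}" "Suc i \<in> {1..<n}" using Suc.prems False by auto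
    have q: "perm ?q"
      using i by (intro permutes_compose permutes_swap_id) auto
    have h: "h ?q = s (Suc i) * s i"
      using i by (subst h_comp[symmetric]) (auto intro: permutes_swap_id simp: h_transpose_Suc)
    have 1: "s i * (t (Suc i) * t i) = s (Suc i) * t i" "s (Suc i) * (t i * t (Suc i)) = s i * t (Suc i)"
      "t i * (t (Suc i) * s i) = t i * s (Suc i)"
      using i rels[OF sigma_theta_theta[of i n "Suc i"]] rels[OF sigma_theta_theta[of "Suc i" n i]]
        rels[OF theta_theta_sigma[of i n "Suc i"]] by auto
    have "t i * t (Suc i) = s (Suc i) * (s i * t (Suc i))"
      using 1(2) s_sq'[OF i(2)] by metis
    moreover have "t i * t (Suc i) = t i * (s (Suc i) * s i)"
      using 1(3) s_sq[OF i(1)] by (metis mult.assoc mult_1_right)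
    ultimately have "conj ?q (t i) = t (Suc i)"
      using q by (intro conj_eqI) (auto simp: h mult.assoc)
    then show ?thesis
      using Suc.IH[OF i(1)] conj_th[OF q, of i "Suc i"] i by auto
  qed
qed simp

text \<open>Interchanging the two ends is conjugation by \<open>s 1\<close>, which
  \<open>t 1\<close> absorbs on both sides by (3).\<close>

lemma th_sym:
  assumes "a \<in> {1..n}" "b \<in> {1..n}" "a \<noteq> b"
  shows "th a b = th b a"
proof -
  obtain q where q: "perm q" "q 1 = a" "q 2 = b" "n \<ge> 2" using ex_perm2[OF assms] .
  have 1: "s 1 * t 1 = t 1" "t 1 * s 1 = t 1"
    using rels[OF sigma_theta, of 1] rels[OF theta_sigma, of 1] q(4) by auto
  have "perm (transpose 1 2)" using q(4) by (intro permutes_swap_id) auto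
  moreover have "h (transpose 1 2) = s 1"
    using h_transpose_Suc[of 1] q(4) by (simp add: numeral_2_eq_2)
  ultimately have "t 1 = conj (transpose 1 2) (t 1)"
    using 1 by (intro conj_eqI[symmetric]) auto
  also have "\<dots> = th 2 1"
    using \<open>perm (transpose 1 2)\<close> q(4) by (simp add: conj_t1)
  finally have "conj q (th 2 1) = conj q (th 1 2)" using q(4) th_1_2 by simp
  then show ?thesis using q by (simp add: conj_th)
qed

text \<open>Each equation is first derived at the indices 1 and 2 from (2), (6), (8) or (9) and then
  conjugated. The last one comes from \<open>e 1 * s 1 * e 1 = e 1 * e 2\<close> by moving the
  second \<open>e 1\<close> to the left past \<open>s 1\<close>.\<close>

lemma th_e_rels:
  assumes "a \<in> {1..n}" "b \<in> {1..n}" "a \<noteq> b"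
  shows th_idem: "th a b * th a b = th a b"
    and th_e_th: "th a b * (e a * th a b) = th a b"
    and e_th: "e a * th a b = e a * (e b * th a b)"
    and e_th': "e b * th a b = e a * (e b * th a b)"
    and th_e: "th a b * e a = th a b * (e a * e b)"
    and e_th_e: "e a * (th a b * e a) = e a * e b"
    and e_e_h: "e a * (e b * h (transpose a b)) = e a * e b"
proof -
  obtain q where q: "perm q" "q 1 = a" "q 2 = b" "n \<ge> 2" using ex_perm2[OF assms] .
  then have r: "1 \<in> {1..<n}" by simp
  have 2: "Suc 0 + 1 = 2" "Suc 0 = 1" "Suc 1 = 2" by auto
  note [simp] = conj_mult[OF q(1)] conj_t1[OF q(4,1)] conj_e[OF q(1)] q(2,3)
  have s1: "s 1 = h (transpose 1 2)"
    using h_transpose_Suc[OF r] by (simp add: 2)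
  have 12: "1 \<in> {1..n}" "2 \<in> {1..n}" using q(4) by auto
  have "t 1 * t 1 = t 1"
    using rels[OF theta_idem[OF r]] by simp
  from arg_cong[OF this, of "conj q"] show "th a b * th a b = th a b" by simp
  have "t 1 * (e 1 * t 1) = t 1"
    using rels[OF theta_vartheta_theta[OF r]] by simp
  from arg_cong[OF this, of "conj q"] show "th a b * (e a * th a b) = th a b" using 12 by simp
  have x: "e 1 * t 1 = e 2 * t 1" "e 2 * t 1 = e 1 * (e 2 * t 1)"
    using rels[OF vartheta_theta_Suc[OF r]] rels[OF vartheta_theta_both[OF r]] by (simp_all add: 2)
  from arg_cong[OF x(2), of "conj q"] show E: "e b * th a b = e a * (e b * th a b)" using 12 by simp
  from arg_cong[OF x(1), of "conj q"] have "e a * th a b = e b * th a b" using 12 by simp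
  with E show "e a * th a b = e a * (e b * th a b)" by simp
  have "t 1 * e 1 = t 1 * (e 1 * e 2)"
    using rels[OF theta_vartheta_Suc[OF r]] rels[OF theta_vartheta_both[OF r]] by (simp add: 2)
  from arg_cong[OF this, of "conj q"] show "th a b * e a = th a b * (e a * e b)" using 12 by simp
  have "e 1 * (t 1 * e 1) = e 1 * e 2"
    using rels[OF vartheta_theta_vartheta[OF r]] by (simp add: 2)
  from arg_cong[OF this, of "conj q"] show "e a * (th a b * e a) = e a * e b" using 12 by simp
  have "e 1 * (s 1 * e 1) = e 1 * e 2"
    using rels[OF vartheta_sigma_vartheta[OF r]] by (simp add: 2)
  moreover have "s 1 * e 1 = e 2 * s 1"
    using rels[OF sigma_vartheta[OF r]] by (simp add: 2)
  ultimately have "e 1 * (e 2 * h (transpose 1 2)) = e 1 * e 2"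
    by (simp add: s1)
  from arg_cong[OF this, of "conj q"] show "e a * (e b * h (transpose a b)) = e a * e b"
    using 12 conj_h_transpose[OF q(1) 12] by simp
qed

lemma th_e_comm:
  assumes "a \<in> {1..n}" "b \<in> {1..n}" "c \<in> {1..n}" "distinct [a, b, c]"
  shows "th a b * e c = e c * th a b"
proof -
  obtain q where q: "perm q" "q 1 = a" "q 2 = b" "q 3 = c" "n \<ge> 3" using ex_perm3[OF assms] .
  have "t 1 * e 3 = e 3 * t 1"
    using rels[OF theta_vartheta_comm[of 1 n 3]] q(5) by simp
  from arg_cong[OF this, of "conj q"] show ?thesis
    using q by (simp add: conj_mult conj_t1 conj_e)
qed

text \<open>This rule absorbs a hook that meets an existing one into a permutation.\<close>

lemma th_th:
  assumes "a \<in> {1..n}" "b \<in> {1..n}" "c \<in> {1..n}" "distinct [a, b, c]"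
  shows "th a b * th b c = th a b * h (transpose a c)"
proof -
  obtain q where q: "perm q" "q 1 = a" "q 2 = b" "q 3 = c" "n \<ge> 3" using ex_perm3[OF assms] .
  have num: "Suc 0 = 1" "Suc 1 = 2" "Suc 2 = 3" by auto
  have r: "1 \<in> {1..<n}" "2 \<in> {1..<n}" using q(5) by auto
  \<comment> \<open>By (4), \<open>t 1 * t 2\<close> is \<open>t 1 * (s 2 * s 1)\<close>. As
    \<open>t 1\<close> absorbs \<open>s 1\<close> on its right, a further \<open>s 1\<close> may be
    inserted, and \<open>s 1 * (s 2 * s 1)\<close> is the transposition of 1 and 3.\<close>
  have "t 1 * (t 2 * s 1) = t 1 * s 2"
    using rels[OF theta_theta_sigma[of 1 n 2]] r by simp
  then have "t 1 * t 2 = t 1 * (s 2 * s 1)"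
    using s_sq[OF r(1)] by (metis mult.assoc mult_1_right)
  moreover have "t 1 * s 1 = t 1" using rels[OF theta_sigma[OF r(1)]] by simp
  moreover have "h (transpose 1 3) = s 1 * (s 2 * s 1)"
  proof -
    have "transpose 1 3 = transpose 1 2 \<circ> transpose 2 3 \<circ> (transpose 1 2 :: nat \<Rightarrow> nat)"
      by (auto simp: fun_eq_iff transpose_def)
    then show ?thesis
      using q(5) h_transpose_Suc[OF r(1)] h_transpose_Suc[OF r(2)]
      by (simp add: num permutes_compose permutes_swap_id flip: h_comp)
  qed
  moreover have "t 2 = th 2 3" using t_eq_th[OF r(2)] by (simp add: num)
  ultimately have "t 1 * th 2 3 = t 1 * h (transpose 1 3)" by (metis mult.assoc)
  from arg_cong[OF this, of "conj q"] show ?thesis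
    using q by (simp add: conj_mult conj_t1 conj_th conj_h_transpose)
qed

lemma th_th_comm:
  assumes "a \<in> {1..n}" "b \<in> {1..n}" "c \<in> {1..n}" "d \<in> {1..n}" "distinct [a, b, c, d]"
  shows "th a b * th c d = th c d * th a b"
proof -
  obtain q where q: "perm q" "q 1 = a" "q 2 = b" "q 3 = c" "q 4 = d" "n \<ge> 4" using ex_perm4[OF assms] .
  have "t 1 * t 3 = t 3 * t 1"
    using rels[OF theta_comm[of 1 n 3]] q(6) by simp
  moreover have "t 3 = th 3 4" using t_eq_th[of 3] q(6) by simp
  ultimately have "t 1 * th 3 4 = th 3 4 * t 1" by simp
  from arg_cong[OF this, of "conj q"] show ?thesis
    using q by (simp add: conj_mult conj_t1 conj_th)
qed

end


section \<open>Partial matchings on a set of points\<close>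

definition hooks :: "nat set \<Rightarrow> nat set set \<Rightarrow> bool" where
  "hooks C u \<longleftrightarrow> disjoint u \<and> (\<forall>B\<in>u. card B = 2 \<and> B \<subseteq> C)"

lemma hooksD:
  assumes "hooks C u" "B \<in> u"
  shows "card B = 2" "B \<subseteq> C" "B' \<in> u \<Longrightarrow> B \<noteq> B' \<Longrightarrow> B \<inter> B' = {}"
proof -
  show "card B = 2" "B \<subseteq> C" using assms unfolding hooks_def by blast+
  have "disjoint u" using assms(1) unfolding hooks_def by blast
  then show "B' \<in> u \<Longrightarrow> B \<noteq> B' \<Longrightarrow> B \<inter> B' = {}"
    using assms(2) disjointD by metis
qed

lemma hooksI:
  assumes "\<And>B. B \<in> u \<Longrightarrow> card B = 2" "\<And>B. B \<in> u \<Longrightarrow> B \<subseteq> C"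
    "\<And>A B. A \<in> u \<Longrightarrow> B \<in> u \<Longrightarrow> A \<noteq> B \<Longrightarrow> A \<inter> B = {}"
  shows "hooks C u"
proof -
  have "disjoint u" by (rule disjointI) (rule assms(3))
  then show ?thesis unfolding hooks_def using assms(1,2) by blast
qed

lemma hooks_mono:
  assumes "hooks C u" "u' \<subseteq> u" "C \<subseteq> C'"
  shows "hooks C' u'"
proof (rule hooksI)
  fix B assume "B \<in> u'"
  then have "B \<in> u" using assms(2) by blast
  then show "card B = 2" "B \<subseteq> C'" using hooksD(1,2)[OF assms(1)] assms(3) by auto
  fix A assume "A \<in> u'" "A \<noteq> B"
  then show "A \<inter> B = {}" using hooksD(3)[OF assms(1), of A B] \<open>B \<in> u\<close> assms(2) by blast
qed

lemma hooks_empty [simp]: "hooks C {}"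
  by (simp add: hooks_def)

lemma hooks_insert:
  assumes "hooks C u" "card B = 2" "B \<inter> \<Union>u = {}" "B \<subseteq> C"
  shows "hooks C (insert B u)"
proof (rule hooksI)
  fix A A' assume A: "A \<in> insert B u" "A' \<in> insert B u" "A \<noteq> A'"
  then consider "A \<in> u" "A' \<in> u" | "A = B" "A' \<in> u" | "A \<in> u" "A' = B" by blast
  then show "A \<inter> A' = {}"
  proof cases
    case 1
    then show ?thesis using hooksD(3)[OF assms(1)] A(3) by metis
  qed (use assms(3) in blast)+
next
  fix A assume "A \<in> insert B u"
  then show "card A = 2" "A \<subseteq> C" using assms(2,4) hooksD(1,2)[OF assms(1), of A] by auto
qed

lemma hooks_image:
  assumes "hooks C u" "inj q"
  shows "hooks (q ` C) ((`) q ` u)"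
proof (rule hooksI)
  fix A assume "A \<in> (`) q ` u"
  then obtain A' where A: "A' \<in> u" "A = q ` A'" by blast
  then show "card A = 2" "A \<subseteq> q ` C"
    using hooksD(1,2)[OF assms(1), of A'] card_image[OF inj_on_subset[OF assms(2) subset_UNIV], of A'] by auto
  fix B assume "B \<in> (`) q ` u" "A \<noteq> B"
  then obtain B' where B: "B' \<in> u" "B = q ` B'" by blast
  with A \<open>A \<noteq> B\<close> have "A' \<noteq> B'" by blast
  then have "A' \<inter> B' = {}" using hooksD(3)[OF assms(1) A(1) B(1)] by simp
  then show "A \<inter> B = {}"
    unfolding A(2) B(2) using image_Int[OF assms(2), of A' B'] by simp
qed

lemma finite_hooks: "hooks C u \<Longrightarrow> finite C \<Longrightarrow> finite u"
  using hooksD(2) by (intro finite_subset[of u "Pow C"]) auto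

lemma hooks_pair:
  assumes "hooks C u" "B \<in> u" "k \<in> B"
  obtains l where "B = {k, l}" "k \<noteq> l" "k \<in> C" "l \<in> C"
proof -
  obtain x y where "B = {x, y}" "x \<noteq> y"
    using hooksD(1)[OF assms(1,2)] unfolding card_2_iff by blast
  then show ?thesis
    using that[of x] that[of y] assms(3) hooksD(2)[OF assms(1,2)] by auto
qed

context PB_rep
begin

section \<open>Products of hooks and of idempotents\<close>

text \<open>\<open>Min\<close> and \<open>Max\<close> merely choose an order of the two ends; by
  \<open>th_sym\<close> the choice is immaterial.\<close>

definition hook_elt :: "nat set \<Rightarrow> 'm" where
  "hook_elt B = th (Min B) (Max B)"

lemma hook_elt_pair:
  assumes "a \<in> {1..n}" "b \<in> {1..n}" "a \<noteq> b"
  shows "hook_elt {a, b} = th a b"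
  using th_sym[OF assms] assms(3) by (cases "a < b") (auto simp: hook_elt_def min_def max_def)

abbreviation Th :: "nat set set \<Rightarrow> 'm" where "Th \<equiv> cprod hook_elt"
abbreviation E :: "nat set \<Rightarrow> 'm" where "E \<equiv> cprod e"

definition hooks_in :: "nat set set \<Rightarrow> bool" where
  "hooks_in u \<longleftrightarrow> hooks {1..n} u"

lemma hooks_inI: "hooks C u \<Longrightarrow> C \<subseteq> {1..n} \<Longrightarrow> hooks_in u"
  unfolding hooks_in_def by (rule hooks_mono[OF _ subset_refl])

lemma hooks_in_pair:
  assumes "hooks_in u" "B \<in> u" "k \<in> B"
  obtains l where "B = {k, l}" "k \<noteq> l" "k \<in> {1..n}" "l \<in> {1..n}" "hook_elt B = th k l"
proof -
  obtain l where l: "B = {k, l}" "k \<noteq> l" "k \<in> {1..n}" "l \<in> {1..n}"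
    using hooks_pair[OF assms[unfolded hooks_in_def]] .
  then show ?thesis using that hook_elt_pair[OF l(3,4,2)] by simp
qed

lemma hook_elt_h:
  assumes "perm q" "B \<subseteq> {1..n}" "card B = 2"
  shows "hook_elt B * h q = h q * hook_elt (q ` B)"
proof -
  obtain a b where ab: "B = {a, b}" "a \<noteq> b" using assms(3) unfolding card_2_iff by auto
  moreover have "q a \<noteq> q b" "q a \<in> {1..n}" "q b \<in> {1..n}"
    using permutes_inj[OF assms(1)] permutes_in_image[OF assms(1)] ab assms(2) by (auto dest: injD)
  ultimately show ?thesis
    using assms(2) th_h[OF assms(1)] hook_elt_pair by auto
qed

lemma hook_elt_commute:
  assumes "A \<subseteq> {1..n}" "B \<subseteq> {1..n}" "card A = 2" "card B = 2" "A \<inter> B = {}"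
  shows "hook_elt A * hook_elt B = hook_elt B * hook_elt A"
proof -
  obtain a b where ab: "A = {a, b}" "a \<noteq> b" using assms(3) unfolding card_2_iff by auto
  obtain c d where cd: "B = {c, d}" "c \<noteq> d" using assms(4) unfolding card_2_iff by auto
  show ?thesis
    using assms(1,2,5) ab cd th_th_comm[of a b c d] hook_elt_pair by auto
qed

lemma hook_elt_e:
  assumes "B \<subseteq> {1..n}" "card B = 2" "k \<in> {1..n}" "k \<notin> B"
  shows "hook_elt B * e k = e k * hook_elt B"
proof -
  obtain a b where ab: "B = {a, b}" "a \<noteq> b" using assms(2) unfolding card_2_iff by auto
  then show ?thesis
    using assms th_e_comm[of a b k] hook_elt_pair by auto
qed

lemma commuting_hook_elt: "hooks_in u \<Longrightarrow> pairwise_commuting hook_elt u"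
  unfolding pairwise_commuting_def hooks_in_def
proof (intro ballI)
  fix A B assume u: "hooks {1..n} u" "A \<in> u" "B \<in> u"
  show "hook_elt A * hook_elt B = hook_elt B * hook_elt A"
    using hook_elt_commute[OF hooksD(2)[OF u(1,2)] hooksD(2)[OF u(1,3)]]
      hooksD(1)[OF u(1,2)] hooksD(1)[OF u(1,3)] hooksD(3)[OF u] by (cases "A = B") simp_all
qed

lemma e_comm: "a \<in> {1..n} \<Longrightarrow> b \<in> {1..n} \<Longrightarrow> e a * e b = e b * e a"
  using rels[OF vartheta_comm[of a n b]] by (cases "a = b") auto

lemma e_idem: "a \<in> {1..n} \<Longrightarrow> e a * e a = e a"
  using rels[OF vartheta_idem[of a n]] by simp

lemma commuting_e: "C \<subseteq> {1..n} \<Longrightarrow> pairwise_commuting e C"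
  unfolding pairwise_commuting_def using e_comm by blast

lemma hooks_in_finite: "hooks_in u \<Longrightarrow> finite u"
  unfolding hooks_in_def by (rule finite_hooks) auto

lemma Th_h:
  assumes "perm q" "hooks_in u"
  shows "Th u * h q = h q * Th ((`) q ` u)"
proof (rule cprod_intertwine)
  have "inj q" using assms(1) by (rule permutes_inj)
  then show "inj_on ((`) q) u" by (auto simp: inj_on_def inj_image_eq_iff)
  have "hooks_in ((`) q ` u)"
    using hooks_image[OF _ \<open>inj q\<close>] assms(2) permutes_image[OF assms(1)] unfolding hooks_in_def by metis
  then show "pairwise_commuting hook_elt ((`) q ` u)" by (rule commuting_hook_elt)
  fix B assume "B \<in> u"
  then show "hook_elt B * h q = h q * hook_elt (q ` B)"
    using assms hooksD unfolding hooks_in_def by (intro hook_elt_h) auto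
qed (rule hooks_in_finite[OF assms(2)] commuting_hook_elt[OF assms(2)])+

lemma E_e_commute: "C \<subseteq> {1..n} \<Longrightarrow> a \<in> {1..n} \<Longrightarrow> E C * e a = e a * E C"
  by (rule cprod_commute[OF finite_subset[OF _ finite_atLeastAtMost] commuting_e]) (blast intro: e_comm)+

lemma E_e_absorb:
  assumes "C \<subseteq> {1..n}" "a \<in> C"
  shows "E C * e a = E C"
proof -
  have C: "finite (C - {a})" "pairwise_commuting e (insert a (C - {a}))"
    using assms finite_subset commuting_e by (auto simp: insert_absorb)
  have "E C = e a * E (C - {a})"
    using cprod_insert[OF C(1) _ C(2)] assms(2) by (simp add: insert_absorb)
  moreover have a: "a \<in> {1..n}" using assms by auto
  ultimately have "e a * E C = E C"
    using e_idem[OF a] by (metis mult.assoc)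
  then show ?thesis using E_e_commute[OF assms(1) a] by simp
qed

lemma E_insert:
  assumes "C \<subseteq> {1..n}" "a \<in> {1..n}"
  shows "E (insert a C) = E C * e a"
proof (cases "a \<in> C")
  case True
  then show ?thesis using E_e_absorb assms by (simp add: insert_absorb)
next
  case False
  then have "E (insert a C) = e a * E C"
    using assms finite_subset[OF assms(1)] by (intro cprod_insert commuting_e) auto
  then show ?thesis using E_e_commute assms by auto
qed

text \<open>Permutations of \<open>C\<close> are generated by transpositions of two of its points,
  and the factors \<open>e a\<close> and \<open>e b\<close> of \<open>E C\<close> absorb the
  transposition of \<open>a\<close> and \<open>b\<close> by \<open>e_e_h\<close>.\<close>

lemma E_h_stabilizer:
  assumes "C \<subseteq> {1..n}" "q permutes C"
  shows "E C * h q = E C"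
  using finite_subset[OF assms(1) finite_atLeastAtMost] assms(2)
proof (induction q rule: permutes_rev_induct)
  case id
  then show ?case by (simp add: h_id[unfolded id_def])
next
  case (swap a b p)
  have ab: "a \<in> {1..n}" "b \<in> {1..n}" using swap assms by auto
  have "E C * h (transpose a b) = E C * e a * e b * h (transpose a b)"
    using E_e_absorb[OF assms(1)] swap by simp
  also have "\<dots> = E C * (e a * e b)"
    using e_e_h[OF ab swap(3)] by (simp add: mult.assoc)
  also have "\<dots> = E C"
    using E_e_absorb[OF assms(1)] swap by (simp flip: mult.assoc)
  finally have "E C * (h (transpose a b) * h p) = E C"
    using swap by (simp flip: mult.assoc)
  moreover have "h (transpose a b) * h p = h (p \<circ> transpose a b)"
    using permutes_subset[OF \<open>p permutes C\<close> assms(1)] ab by (simp add: h_comp permutes_swap_id)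
  ultimately show ?case by (simp add: comp_def)
qed

text \<open>The two permutations differ by one that moves only points of \<open>C\<close>, and in
  the right action this correction stands directly behind \<open>E C\<close>, where it is
  absorbed.\<close>

lemma E_h_cong:
  assumes "C \<subseteq> {1..n}" "perm p" "perm q" "\<And>j. j \<in> {1..n} - C \<Longrightarrow> p j = q j"
  shows "E C * h p = E C * h q"
proof -
  define u where "u = inv p \<circ> q"
  have u: "perm u" using assms unfolding u_def by (intro permutes_compose permutes_inv)
  moreover have "u x = x" if "x \<in> {1..n} - C" for x
    using assms(4)[OF that, symmetric] assms(2) by (simp add: u_def permutes_inverses)
  ultimately have "u permutes C" by (rule permutes_superset)
  then have "E C * h u = E C" using assms(1) by (intro E_h_stabilizer)
  moreover have "q = p \<circ> u"
    using assms(2) by (auto simp: u_def fun_eq_iff permutes_inverses)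
  then have "h q = h u * h p" using h_comp[OF u assms(2)] by simp
  ultimately show ?thesis by (simp flip: mult.assoc)
qed

lemma Th_e:
  assumes "hooks_in u" "k \<in> {1..n}" "k \<notin> \<Union>u"
  shows "Th u * e k = e k * Th u"
proof (rule cprod_commute)
  fix B assume B: "B \<in> u"
  then have "card B = 2" "B \<subseteq> {1..n}"
    using assms(1) hooksD(1,2) unfolding hooks_in_def by blast+
  moreover have "k \<notin> B" using assms(3) B by blast
  ultimately show "hook_elt B * e k = e k * hook_elt B"
    using assms(2) by (intro hook_elt_e)
qed (rule hooks_in_finite[OF assms(1)] commuting_hook_elt[OF assms(1)])+

lemma Th_insert:
  assumes "hooks_in (insert B u)" "B \<notin> u"
  shows "Th (insert B u) = hook_elt B * Th u" "Th (insert B u) = Th u * hook_elt B"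
proof -
  have u: "hooks_in u" using assms(1) hooks_mono unfolding hooks_in_def by blast
  show *: "Th (insert B u) = hook_elt B * Th u"
    by (rule cprod_insert[OF hooks_in_finite[OF u] assms(2) commuting_hook_elt[OF assms(1)]])
  have "Th u * hook_elt B = hook_elt B * Th u"
  proof (rule cprod_commute[OF hooks_in_finite[OF u] commuting_hook_elt[OF u]])
    fix A assume "A \<in> u"
    then show "hook_elt A * hook_elt B = hook_elt B * hook_elt A"
      using commuting_hook_elt[OF assms(1)] unfolding pairwise_commuting_def by blast
  qed
  then show "Th (insert B u) = Th u * hook_elt B" unfolding * ..
qed

section \<open>Closure of the normal forms under right multiplication by generators\<close>

definition normal_form :: "nat set set \<Rightarrow> nat set \<Rightarrow> (nat \<Rightarrow> nat) \<Rightarrow> nat set set \<Rightarrow> 'm" where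
  "normal_form u C p v = Th u * (E C * (h p * Th v))"

definition valid :: "nat set set \<Rightarrow> nat set \<Rightarrow> (nat \<Rightarrow> nat) \<Rightarrow> nat set set \<Rightarrow> bool" where
  "valid u C p v \<longleftrightarrow> C \<subseteq> {1..n} \<and> perm p \<and> hooks C u \<and> hooks (p ` C) v"

lemma validD:
  assumes "valid u C p v"
  shows "C \<subseteq> {1..n}" "perm p" "hooks C u" "hooks (p ` C) v" "p ` C \<subseteq> {1..n}" "hooks_in u" "hooks_in v"
proof -
  show V: "C \<subseteq> {1..n}" "perm p" "hooks C u" "hooks (p ` C) v"
    using assms unfolding valid_def by blast+
  show "p ` C \<subseteq> {1..n}" using image_mono[OF V(1), of p] unfolding permutes_image[OF V(2)] .
  then show "hooks_in u" "hooks_in v"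
    using hooks_inI[OF V(3,1)] hooks_inI[OF V(4)] by blast+
qed

definition normal_forms :: "'m set" where
  "normal_forms = {normal_form u C p v |u C p v. valid u C p v}"

lemma normal_formsI: "x = normal_form u C p v \<Longrightarrow> valid u C p v \<Longrightarrow> x \<in> normal_forms"
  unfolding normal_forms_def by blast

lemma normal_form_h:
  assumes "valid u C p v" "perm q"
  shows "normal_form u C p v * h q \<in> normal_forms"
proof (rule normal_formsI)
  note V = validD[OF assms(1)]
  show "normal_form u C p v * h q = normal_form u C (q \<circ> p) ((`) q ` v)"
    using Th_h[OF assms(2) V(7)] h_comp[OF V(2) assms(2)]
    by (simp add: normal_form_def mult.assoc) (simp flip: mult.assoc)
  show "valid u C (q \<circ> p) ((`) q ` v)"
    using V assms(2) hooks_image[OF V(4) permutes_inj[OF assms(2)]]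
    by (auto simp: valid_def permutes_compose image_comp)
qed

lemma h_e: "perm p \<Longrightarrow> k \<in> {1..n} \<Longrightarrow> h p * (e k * x) = e (inv p k) * (h p * x)"
  using e_h[of p "inv p k"] permutes_in_image[OF permutes_inv, of p "{1..n}" k]
  by (simp add: permutes_inverses flip: mult.assoc)

text \<open>Cutting a strand below the permutation is the same as cutting it above. The trailing
  factor \<open>x\<close> allows the rule to act in the middle of a longer product.\<close>

lemma E_h_e:
  assumes "perm p" "C \<subseteq> {1..n}" "k \<in> {1..n}"
  shows "E C * (h p * (e k * x)) = E (insert (inv p k) C) * (h p * x)"
  using assms permutes_in_image[OF permutes_inv, of p "{1..n}" k]
  by (simp add: h_e E_insert mult.assoc)

text \<open>Mostly read from right to left: on a lower point without a strand, a factor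
  \<open>e k\<close> can be inserted for free.\<close>

lemma E_h_e_absorb:
  assumes "valid u C p v" "k \<in> p ` C"
  shows "E C * (h p * (e k * x)) = E C * (h p * x)"
proof -
  note V = validD[OF assms(1)]
  have "k \<in> {1..n}" "inv p k \<in> C"
    using assms(2) V by (auto simp: permutes_inverses)
  then show ?thesis using E_h_e[OF V(2,1)] by (simp add: insert_absorb)
qed

text \<open>If \<open>k\<close> is on no lower hook, \<open>e k\<close> rises past
  \<open>Th v\<close> and through \<open>p\<close>, and cuts the strand at \<open>inv p k\<close>.
  If \<open>k\<close> is on the hook \<open>{k, l}\<close>, a second \<open>e k\<close> is inserted
  above it, and \<open>e k * th k l * e k = e k * e l\<close> dissolves the hook.\<close>

lemma normal_form_e:
  assumes "valid u C p v" "k \<in> {1..n}"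
  shows "normal_form u C p v * e k \<in> normal_forms"
proof (cases "k \<in> \<Union>v")
  case False
  note V = validD[OF assms(1)]
  have k: "inv p k \<in> {1..n}" using permutes_in_image[OF permutes_inv[OF V(2)]] assms(2) by blast
  show ?thesis
  proof (rule normal_formsI)
    show "normal_form u C p v * e k = normal_form u (insert (inv p k) C) p v"
      using Th_e[OF V(7) assms(2) False] E_h_e[OF V(2,1) assms(2)]
      by (simp add: normal_form_def mult.assoc)
    show "valid u (insert (inv p k) C) p v"
      using V k hooks_mono[OF V(3), of u "insert (inv p k) C"]
        hooks_mono[OF V(4), of v "p ` insert (inv p k) C"] by (auto simp: valid_def)
  qed
next
  case True
  note V = validD[OF assms(1)]
  then obtain B where B: "B \<in> v" "k \<in> B" using True by auto
  then obtain l where l: "B = {k, l}" "k \<noteq> l" "l \<in> {1..n}" "hook_elt B = th k l"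
    using hooks_in_pair[OF V(7)] by metis
  have kl: "k \<in> p ` C" "l \<in> p ` C" using hooksD(2)[OF V(4) B(1)] l by auto
  define v' where "v' = v - {B}"
  have v: "v = insert B v'" "B \<notin> v'" using B by (auto simp: v'_def)
  have v': "hooks (p ` C) v'" using hooks_mono[OF V(4)] v by auto
  then have "hooks_in v'" using V(5) by (rule hooks_inI)
  moreover have "k \<notin> \<Union>v'"
    using hooksD(3)[OF V(4) B(1)] B(2) unfolding v'_def by blast
  ultimately have "Th v' * e k = e k * Th v'" using assms(2) by (intro Th_e)
  then have Thv: "Th v * e k = th k l * (e k * Th v')"
    using Th_insert(1)[of B v'] V(7) v l by (simp add: mult.assoc)
  show ?thesis
  proof (rule normal_formsI)
    have "E C * (h p * (th k l * (e k * Th v'))) = E C * (h p * (e k * (th k l * (e k * Th v'))))"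
      using E_h_e_absorb[OF assms(1) kl(1)] by simp
    also have "\<dots> = E C * (h p * (e k * (e l * Th v')))"
      using e_th_e[OF assms(2) l(3,2)] by (simp flip: mult.assoc)
    also have "\<dots> = E C * (h p * Th v')"
      using E_h_e_absorb[OF assms(1)] kl by simp
    finally show "normal_form u C p v * e k = normal_form u C p v'"
      by (simp add: normal_form_def mult.assoc Thv)
    show "valid u C p v'" using V v' by (auto simp: valid_def)
  qed
qed

text \<open>The partner \<open>x\<close> of \<open>k\<close> supplies a factor \<open>th x k\<close>
  that can be placed last in \<open>Th v\<close>; by \<open>th_th\<close> the new hook then acts as
  the transposition of \<open>x\<close> and \<open>l\<close>. The point \<open>l\<close> may itself
  lie on another hook.\<close>

lemma Th_mult_th_overlap:
  assumes "hooks_in v" "k \<in> \<Union>v" "{k, l} \<notin> v" "l \<in> {1..n}" "k \<noteq> l"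
  obtains x where "x \<in> {1..n}" "Th v * th k l = Th v * h (transpose x l)"
proof -
  from assms obtain B where B: "B \<in> v" "k \<in> B" by auto
  then obtain x where x: "B = {k, x}" "k \<noteq> x" "k \<in> {1..n}" "x \<in> {1..n}" "hook_elt B = th k x"
    using hooks_in_pair[OF assms(1)] by metis
  have "x \<noteq> l" using assms(3) B x by auto
  have v: "v = insert B (v - {B})" using B by auto
  have *: "Th v = Th (v - {B}) * th x k"
    using Th_insert(2)[of B "v - {B}"] v assms(1) x th_sym[of k x] by (metis Diff_iff singletonI)
  have "th x k * th k l = th x k * h (transpose x l)"
    using th_th[of x k l] x assms \<open>x \<noteq> l\<close> by auto
  then have "Th v * th k l = Th v * h (transpose x l)"
    unfolding * by (simp add: mult.assoc)
  then show ?thesis using that x by blast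
qed

text \<open>With \<open>a\<close> and \<open>b\<close> the upper ends belonging to \<open>k\<close>
  and \<open>l\<close>, at least one of them in \<open>C\<close> means that at most one strand is
  lost and no upper hook arises. Otherwise the hook joins two strands, and \<open>{a, b}\<close>
  becomes an upper hook.\<close>

lemma normal_form_th_free:
  assumes "valid u C p v" "k \<in> {1..n}" "l \<in> {1..n}" "k \<noteq> l" "k \<notin> \<Union>v" "l \<notin> \<Union>v"
  shows "normal_form u C p v * th k l \<in> normal_forms"
proof -
  note V = validD[OF assms(1)]
  define a where "a = inv p k"
  define b where "b = inv p l"
  define D where "D = insert a (insert b C)"
  have ab: "a \<in> {1..n}" "b \<in> {1..n}" "a \<noteq> b" "p a = k" "p b = l"
  proof -
    show "a \<in> {1..n}" "b \<in> {1..n}"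
      unfolding a_def b_def permutes_in_image[OF permutes_inv[OF V(2)]] by (fact assms)+
    show "p a = k" "p b = l"
      unfolding a_def b_def by (rule permutes_inverses(1)[OF V(2)])+
    then show "a \<noteq> b" using assms(4) by blast
  qed
  have kl: "card {k, l} = 2" "{k, l} \<inter> \<Union>v = {}" "{k, l} \<subseteq> {1..n}" "{k, l} \<subseteq> p ` D"
    using assms ab(4,5) by (auto simp: D_def)
  have v': "hooks_in (insert {k, l} v)"
    using V(7) kl unfolding hooks_in_def by (intro hooks_insert)
  have "C \<subseteq> D" by (auto simp: D_def)
  then have "hooks D u" "hooks (p ` D) v"
    using hooks_mono[OF V(3) subset_refl] hooks_mono[OF V(4) subset_refl] by (blast, blast)
  then have D: "D \<subseteq> {1..n}" "perm p" "hooks D u" "hooks (p ` D) (insert {k, l} v)"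
    using V(1,2) ab(1,2) kl hooks_insert by (auto simp: D_def)
  have "{k, l} \<notin> v" using assms by auto
  have Thv: "Th v * th k l = th k l * Th v" "Th (insert {k, l} v) = th k l * Th v"
    using Th_insert[OF v' \<open>{k, l} \<notin> v\<close>] hook_elt_pair[OF assms(2-4)] by auto
  have ED: "E C * (h p * (e k * (e l * x))) = E D * (h p * x)" for x
    using E_h_e[OF V(2,1) assms(2)] E_h_e[OF V(2) _ assms(3), of "insert a C"] ab(1) V(1)
    by (simp add: a_def b_def D_def insert_commute)
  have NF: "normal_form u C p v * th k l = Th u * (E C * (h p * (th k l * Th v)))"
    by (simp add: normal_form_def mult.assoc Thv)
  show ?thesis
  proof (cases "a \<in> C \<or> b \<in> C")
    case True
    \<comment> \<open>One of the two \<vartheta>'s comes for free from \<open>E C\<close>, and in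
      front of the hook it brings the other with it by (8).\<close>
    have "E C * (h p * (th k l * Th v)) = E C * (h p * (e k * (e l * (th k l * Th v))))"
    proof (cases "a \<in> C")
      case True
      then have "k \<in> p ` C" using ab by auto
      then have "E C * (h p * (th k l * Th v)) = E C * (h p * (e k * (th k l * Th v)))"
        using E_h_e_absorb[OF assms(1)] by simp
      also have "\<dots> = E C * (h p * (e k * (e l * (th k l * Th v))))"
        using e_th[OF assms(2-4)] by (simp flip: mult.assoc)
      finally show ?thesis .
    next
      case False
      then have "l \<in> p ` C" using ab \<open>a \<in> C \<or> b \<in> C\<close> by auto
      then have "E C * (h p * (th k l * Th v)) = E C * (h p * (e l * (th k l * Th v)))"
        using E_h_e_absorb[OF assms(1)] by simp
      also have "e l * (th k l * Th v) = e k * (e l * (th k l * Th v))"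
        using arg_cong[OF e_th'[OF assms(2-4)], of "\<lambda>y. y * Th v"] by (simp only: mult.assoc)
      finally show ?thesis .
    qed
    then have "normal_form u C p v * th k l = normal_form u D p (insert {k, l} v)"
      unfolding NF ED by (simp add: normal_form_def Thv)
    then show ?thesis
      by (rule normal_formsI) (use D in \<open>simp add: valid_def\<close>)
  next
    case False
    have u': "hooks_in (insert {a, b} u)" "{a, b} \<notin> u" "hooks D (insert {a, b} u)"
    proof -
      have "\<Union>u \<subseteq> C" using hooksD(2)[OF V(3)] by blast
      then have ab_u: "{a, b} \<inter> \<Union>u = {}" using False by blast
      show "hooks D (insert {a, b} u)"
        using ab(3) by (intro hooks_insert[OF D(3) _ ab_u]) (auto simp: D_def)
      then show "hooks_in (insert {a, b} u)" using D(1) by (rule hooks_inI)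
      show "{a, b} \<notin> u" using ab_u by blast
    qed
    have Thu: "Th (insert {a, b} u) = Th u * th a b"
      using Th_insert(2)[OF u'(1,2)] hook_elt_pair[OF ab(1-3)] by simp
    \<comment> \<open>The ends \<open>a\<close> and \<open>b\<close> lie outside \<open>C\<close>,
      so the hook produced above the permutation may pass \<open>E C\<close> and join
      \<open>Th u\<close>.\<close>
    have EC: "E C * th a b = th a b * E C"
    proof (rule cprod_commute)
      fix c assume "c \<in> C"
      then show "e c * th a b = th a b * e c"
        using False ab(1-3) V(1) by (intro th_e_comm[symmetric]) auto
    qed (rule finite_subset[OF V(1) finite_atLeastAtMost] commuting_e[OF V(1)])+
    \<comment> \<open>The hook is duplicated with \<open>e k * e l\<close> in between: the left copy
      will rise through \<open>h p\<close> and turn into \<open>th a b\<close>, the right copy joins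
      \<open>v\<close>, and the idempotents enlarge \<open>C\<close> to \<open>D\<close>.\<close>
    have "th k l = th k l * e k * th k l"
      using th_e_th[OF assms(2-4)] by (simp only: mult.assoc)
    also have "\<dots> = th k l * (e k * (e l * th k l))"
      by (simp only: th_e[OF assms(2-4)] mult.assoc)
    finally have "th k l = th k l * (e k * (e l * th k l))" .
    from arg_cong[OF this, of "\<lambda>y. y * Th v"]
    have "th k l * Th v = th k l * (e k * (e l * (th k l * Th v)))"
      by (simp only: mult.assoc)
    then have "E C * (h p * (th k l * Th v)) = E C * (h p * (th k l * (e k * (e l * (th k l * Th v)))))"
      by (rule arg_cong)
    also have "\<dots> = E C * (th a b * (h p * (e k * (e l * (th k l * Th v)))))"
      using th_h[OF V(2) ab(1-3)] ab by (simp flip: mult.assoc)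
    also have "\<dots> = E C * th a b * (h p * (e k * (e l * (th k l * Th v))))"
      by (simp only: mult.assoc)
    also have "\<dots> = th a b * (E D * (h p * (th k l * Th v)))"
      by (simp only: EC mult.assoc ED)
    finally have "normal_form u C p v * th k l = normal_form (insert {a, b} u) D p (insert {k, l} v)"
      unfolding NF by (simp add: normal_form_def Thu Thv mult.assoc)
    then show ?thesis
      by (rule normal_formsI) (use D u' in \<open>simp add: valid_def\<close>)
  qed
qed

text \<open>A hook already in \<open>v\<close> is absorbed by idempotence; a hook that touches
  \<open>v\<close> otherwise becomes a transposition; only a hook disjoint from \<open>v\<close> can
  change the number of strands.\<close>

lemma normal_form_th:
  assumes "valid u C p v" "k \<in> {1..n}" "l \<in> {1..n}" "k \<noteq> l"
  shows "normal_form u C p v * th k l \<in> normal_forms"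
proof -
  note V = validD[OF assms(1)]
  have overlap: "normal_form u C p v * th k l \<in> normal_forms"
    if kl: "k \<in> \<Union>v" "{k, l} \<notin> v" "k \<in> {1..n}" "l \<in> {1..n}" "k \<noteq> l" for k l
  proof -
    obtain x where x: "x \<in> {1..n}" "Th v * th k l = Th v * h (transpose x l)"
      using Th_mult_th_overlap[OF V(7) kl(1,2,4,5)] .
    then have "normal_form u C p v * th k l = normal_form u C p v * h (transpose x l)"
      by (simp add: normal_form_def mult.assoc)
    then show ?thesis
      using normal_form_h[OF assms(1)] permutes_swap_id x kl by metis
  qed
  consider "{k, l} \<in> v" | "{k, l} \<notin> v" "k \<in> \<Union>v" | "{k, l} \<notin> v" "l \<in> \<Union>v" | "k \<notin> \<Union>v" "l \<notin> \<Union>v"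
    by auto
  then show ?thesis
  proof cases
    case 1
    have "Th v = Th (v - {{k, l}}) * th k l"
      using Th_insert(2)[of "{k, l}" "v - {{k, l}}"] 1 V(7) hook_elt_pair[OF assms(2-4)]
      by (simp add: insert_absorb)
    then have "Th v * th k l = Th v"
      using th_idem[OF assms(2-4)] by (simp add: mult.assoc)
    then have "normal_form u C p v * th k l = normal_form u C p v"
      by (simp add: normal_form_def mult.assoc)
    then show ?thesis using assms(1) normal_formsI by blast
  next
    case 2
    then show ?thesis using overlap assms by blast
  next
    case 3
    then have "normal_form u C p v * th l k \<in> normal_forms"
      using overlap[of l k] assms by (simp add: insert_commute)
    then show ?thesis using th_sym[OF assms(2-4)] by simp
  next
    case 4
    then show ?thesis using normal_form_th_free assms by blast
  qed
qed

lemma normal_forms_mult_gen: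
  assumes "x \<in> normal_forms" "g \<in> PB_gens n"
  shows "x * val g \<in> normal_forms"
proof -
  obtain u C p v where x: "x = normal_form u C p v" "valid u C p v"
    using assms(1) by (auto simp: normal_forms_def)
  consider i where "i \<in> {1..<n}" "g = \<sigma> i" | i where "i \<in> {1..<n}" "g = \<theta> i" | i where "i \<in> {1..n}" "g = var\<theta> i"
    using assms(2) by (auto simp: PB_gens_def)
  then show ?thesis
  proof cases
    case 1
    then have "perm (transpose i (Suc i))" by (intro permutes_swap_id) auto
    then show ?thesis using normal_form_h[OF x(2)] h_transpose_Suc[OF 1(1)] x 1 by metis
  next
    case 2
    then show ?thesis using normal_form_th[OF x(2), of i "Suc i"] t_eq_th[OF 2(1)] x by auto
  next
    case 3
    then show ?thesis using normal_form_e[OF x(2)] x by simp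
  qed
qed

lemma prod_list_in_normal_forms: "w \<in> lists (PB_gens n) \<Longrightarrow> prod_list (map val w) \<in> normal_forms"
proof (induction w rule: rev_induct)
  case Nil
  have "valid {} {} id {}" by (simp add: valid_def permutes_id)
  moreover have "normal_form {} {} id {} = 1" unfolding normal_form_def h_id by simp
  ultimately show ?case by (auto intro!: normal_formsI)
next
  case (snoc g w)
  then show ?case using normal_forms_mult_gen by simp
qed

end

section \<open>Words as relations between labellings\<close>


text \<open>
  \<open>word_rel w f g\<close>: labelling the upper row by \<open>f\<close> and the lower row by \<open>g\<close> can be extended to a labelling
  of the whole diagram of \<open>w\<close> that is constant on connected components. Rows are indexed by all natural
  numbers; points outside \<open>{1..n}\<close> are joined vertically.
\<close>

fun word_rel :: "gen list \<Rightarrow> (nat \<Rightarrow> bool) \<Rightarrow> (nat \<Rightarrow> bool) \<Rightarrow> bool" where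
  "word_rel [] f g \<longleftrightarrow> f = g"
| "word_rel (\<sigma> i # w) f g \<longleftrightarrow> word_rel w (f \<circ> transpose i (Suc i)) g"
| "word_rel (\<theta> i # w) f g \<longleftrightarrow>
    f i = f (Suc i) \<and> (\<exists>b. word_rel w (f(i := b, Suc i := b)) g)"
| "word_rel (var\<theta> i # w) f g \<longleftrightarrow> (\<exists>b. word_rel w (f(i := b)) g)"

lemma word_rel_append: "word_rel (u @ v) f g \<longleftrightarrow> (\<exists>k. word_rel u f k \<and> word_rel v k g)"
proof (induction u arbitrary: f)
  case (Cons x u)
  have "word_rel (u @ v) h g \<longleftrightarrow> (\<exists>k. word_rel u h k \<and> word_rel v k g)" for h
    by (rule Cons.IH)
  then show ?case by (cases x) auto
qed simp

lemma word_rel_singleton: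
  "word_rel [\<sigma> i] f g \<longleftrightarrow> (\<forall>x. f (transpose i (Suc i) x) = g x)"
  "word_rel [\<theta> i] f g \<longleftrightarrow> f i = f (Suc i) \<and> g i = g (Suc i) \<and> (\<forall>x. x \<noteq> i \<longrightarrow> x \<noteq> Suc i \<longrightarrow> f x = g x)"
  "word_rel [var\<theta> i] f g \<longleftrightarrow> (\<forall>x. x \<noteq> i \<longrightarrow> f x = g x)"
proof -
  show "word_rel [\<sigma> i] f g \<longleftrightarrow> (\<forall>x. f (transpose i (Suc i) x) = g x)"
    by (simp add: fun_eq_iff)
  have "g = f(i := g i, Suc i := g i)" if "g i = g (Suc i)" "\<forall>x. x \<noteq> i \<longrightarrow> x \<noteq> Suc i \<longrightarrow> f x = g x"
    using that by (simp add: fun_eq_iff)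
  moreover have "g i = g (Suc i) \<and> (\<forall>x. x \<noteq> i \<longrightarrow> x \<noteq> Suc i \<longrightarrow> f x = g x)" if "f(i := b, Suc i := b) = g" for b
    by (simp flip: that)
  ultimately show "word_rel [\<theta> i] f g \<longleftrightarrow> f i = f (Suc i) \<and> g i = g (Suc i) \<and> (\<forall>x. x \<noteq> i \<longrightarrow> x \<noteq> Suc i \<longrightarrow> f x = g x)"
    unfolding word_rel.simps by metis
  have "g = f(i := g i)" if "\<forall>x. x \<noteq> i \<longrightarrow> f x = g x"
    using that by (simp add: fun_eq_iff)
  then show "word_rel [var\<theta> i] f g \<longleftrightarrow> (\<forall>x. x \<noteq> i \<longrightarrow> f x = g x)"
    unfolding word_rel.simps by (metis fun_upd_other)
qed

text \<open>The free label behind a hook or a cut becomes a disjunction over \<open>True\<close> and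
  \<open>False\<close>, and unfolding stops at the last letter, where
  \<open>word_rel_singleton\<close> applies. Short words thus reduce to nearly propositional
  formulas.\<close>

lemma word_rel_Cons_Cons:
  "word_rel (\<sigma> i # x # w) f g \<longleftrightarrow> word_rel (x # w) (f \<circ> transpose i (Suc i)) g"
  "word_rel (\<theta> i # x # w) f g \<longleftrightarrow> f i = f (Suc i) \<and>
    (word_rel (x # w) (f(i := True, Suc i := True)) g \<or> word_rel (x # w) (f(i := False, Suc i := False)) g)"
  "word_rel (var\<theta> i # x # w) f g \<longleftrightarrow>
    word_rel (x # w) (f(i := True)) g \<or> word_rel (x # w) (f(i := False)) g"
  by (simp_all add: ex_bool_eq)

declare word_rel.simps(2-4) [simp del]

lemmas word_rel_normalize = word_rel_singleton word_rel_Cons_Cons all_conj_distrib imp_conjR transpose_def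
  Suc_eq_plus1[symmetric]

text \<open>Brings the guards of the remaining quantifier into one order, so that the propositional
  solver sees identical atoms.\<close>

lemma neq_Suc_order: "(x \<noteq> Suc i \<longrightarrow> x \<noteq> i \<longrightarrow> P) \<longleftrightarrow> (x \<noteq> i \<longrightarrow> x \<noteq> Suc i \<longrightarrow> P)"
  by blast

lemma all_split_at: "(\<forall>x. P x) \<longleftrightarrow> P a \<and> (\<forall>x. x \<noteq> a \<longrightarrow> P x)"
  by metis

text \<open>The two sides exempt different sets of indices from the comparison of \<open>f\<close>
  and \<open>g\<close>; the third index is therefore split off the quantifier beforehand.\<close>

lemma word_rel_theta_theta_theta:
  "word_rel [\<theta> i, \<theta> (Suc i), \<theta> i] f g \<longleftrightarrow> word_rel [\<theta> i] f g"
  "word_rel [\<theta> (Suc i), \<theta> i, \<theta> (Suc i)] f g \<longleftrightarrow> word_rel [\<theta> (Suc i)] f g"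
proof -
  have "(\<forall>x. x \<noteq> i \<longrightarrow> x \<noteq> Suc i \<longrightarrow> f x = g x) \<longleftrightarrow> f (Suc (Suc i)) = g (Suc (Suc i)) \<and>
      (\<forall>x. x \<noteq> Suc (Suc i) \<longrightarrow> x \<noteq> i \<longrightarrow> x \<noteq> Suc i \<longrightarrow> f x = g x)"
    using all_split_at[of "\<lambda>x. x \<noteq> i \<longrightarrow> x \<noteq> Suc i \<longrightarrow> f x = g x" "Suc (Suc i)"] by simp
  then show "word_rel [\<theta> i, \<theta> (Suc i), \<theta> i] f g \<longleftrightarrow> word_rel [\<theta> i] f g"
    by (auto simp: word_rel_normalize)
  have "(\<forall>x. x \<noteq> Suc i \<longrightarrow> x \<noteq> Suc (Suc i) \<longrightarrow> f x = g x) \<longleftrightarrow> f i = g i \<and>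
      (\<forall>x. x \<noteq> i \<longrightarrow> x \<noteq> Suc i \<longrightarrow> x \<noteq> Suc (Suc i) \<longrightarrow> f x = g x)"
    using all_split_at[of "\<lambda>x. x \<noteq> Suc i \<longrightarrow> x \<noteq> Suc (Suc i) \<longrightarrow> f x = g x" i] by simp
  then show "word_rel [\<theta> (Suc i), \<theta> i, \<theta> (Suc i)] f g \<longleftrightarrow> word_rel [\<theta> (Suc i)] f g"
    by (auto simp: word_rel_normalize)
qed

text \<open>Every generator gives a symmetric relation, so reversing a word turns its diagram upside
  down. Mirror images of relations come for free, as used for the second half of (4).\<close>

lemma word_rel_rev: "word_rel (rev w) f g \<longleftrightarrow> word_rel w g f"
proof (induction w arbitrary: f g)
  case (Cons x w)
  have IH: "word_rel (rev w) k l \<longleftrightarrow> word_rel w l k" for k l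
    by (rule Cons.IH)
  have sym: "word_rel [x] k l \<longleftrightarrow> word_rel [x] l k" for k l
  proof (cases x)
    case (\<sigma> i)
    then show ?thesis by (auto simp: word_rel.simps comp_assoc)
  next
    case (\<theta> i)
    then show ?thesis unfolding \<theta> word_rel_singleton by metis
  next
    case (var\<theta> i)
    then show ?thesis unfolding var\<theta> word_rel_singleton by metis
  qed
  have "word_rel (rev (x # w)) f g \<longleftrightarrow> (\<exists>k. word_rel w k f \<and> word_rel [x] g k)"
    by (simp add: word_rel_append IH sym[of g])
  also have "\<dots> \<longleftrightarrow> word_rel ([x] @ w) g f"
    unfolding word_rel_append by blast
  finally show ?case by simp
qed auto

lemma word_rel_sigma_theta_theta:
  assumes "j = Suc i \<or> i = Suc j"
  shows "word_rel [\<sigma> i, \<theta> j, \<theta> i] f g \<longleftrightarrow> word_rel [\<sigma> j, \<theta> i] f g"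
  using assms by (elim disjE) (simp_all add: word_rel_normalize, satx+)

text \<open>Soundness of the relations: each concerns a few neighbouring points only, so it becomes
  a statement about the labels there and equality of the labels elsewhere.\<close>

lemma word_rel_PB_rels:
  "(u, v) \<in> PB_rels n \<Longrightarrow> word_rel u f g \<longleftrightarrow> word_rel v f g"
proof (induction rule: PB_rels.induct)
  case (sigma_sq i) then show ?case by (simp add: comp_assoc word_rel.simps)
next
  case (sigma_comm i j)
  then have "transpose i (Suc i) \<circ> transpose j (Suc j) = transpose j (Suc j) \<circ> transpose i (Suc i)"
    by (auto simp: ex_bool_eq fun_eq_iff transpose_def)
  then show ?case by (simp add: comp_assoc word_rel.simps)
next
  case (sigma_braid i j)
  then have "transpose i (Suc i) \<circ> transpose j (Suc j) \<circ> transpose i (Suc i) =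
      transpose j (Suc j) \<circ> transpose i (Suc i) \<circ> transpose j (Suc j)"
    by (auto simp: ex_bool_eq fun_eq_iff transpose_def)
  then show ?case by (simp add: comp_assoc word_rel.simps)
next
  case (theta_idem i) then show ?case by (simp add: word_rel_normalize neq_Suc_order; satx)
next
  case (theta_comm i j)
  then have "i \<noteq> j" "Suc i \<noteq> j" "i \<noteq> Suc j" by auto
  then show ?case by (auto simp: word_rel_normalize)
next
  case (theta_theta_theta i j)
  then consider "j = Suc i" | "i = Suc j" by linarith
  then show ?case by cases (simp_all add: word_rel_theta_theta_theta)
next
  case (theta_sigma i) then show ?case by (simp add: word_rel_normalize neq_Suc_order; satx)
next
  case (sigma_theta i) then show ?case by (simp add: word_rel_normalize neq_Suc_order; satx)
next
  case (theta_sigma_comm i j)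
  then have "i \<noteq> j" "Suc i \<noteq> j" "i \<noteq> Suc j" by auto
  then show ?case by (auto simp: word_rel_normalize)
next
  case (sigma_theta_theta i j)
  then show ?case by (intro word_rel_sigma_theta_theta) linarith
next
  case (theta_theta_sigma i j)
  then have "j = Suc i \<or> i = Suc j" by linarith
  from word_rel_sigma_theta_theta[OF this, of g f] show ?case
    using word_rel_rev[of "[\<theta> i, \<theta> j, \<sigma> i]" g f] word_rel_rev[of "[\<theta> i, \<sigma> j]" g f] by simp
next
  case (vartheta_idem i) then show ?case by (simp add: word_rel_normalize neq_Suc_order; satx)
next
  case (vartheta_comm i j) then show ?case by (auto simp: word_rel_normalize)
next
  case (sigma_vartheta i) then show ?case by (simp add: word_rel_normalize neq_Suc_order; satx)
next
  case (sigma_vartheta_comm i j) then show ?case by (auto simp: word_rel_normalize)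
next
  case (vartheta_sigma_vartheta i) then show ?case by (simp add: word_rel_normalize neq_Suc_order; satx)
next
  case (theta_vartheta_comm i j) then show ?case by (auto simp: word_rel_normalize)
next
  case (theta_vartheta_Suc i) then show ?case by (simp add: word_rel_normalize neq_Suc_order; satx)
next
  case (theta_vartheta_both i) then show ?case by (simp add: word_rel_normalize neq_Suc_order; satx)
next
  case (vartheta_theta_Suc i) then show ?case by (simp add: word_rel_normalize neq_Suc_order; satx)
next
  case (vartheta_theta_both i) then show ?case by (simp add: word_rel_normalize neq_Suc_order; satx)
next
  case (theta_vartheta_theta i) then show ?case by (simp add: word_rel_normalize neq_Suc_order; satx)
next
  case (vartheta_theta_vartheta i) then show ?case by (simp add: word_rel_normalize neq_Suc_order; satx)
qed

section \<open>Partitions as relations between labellings\<close>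


fun labelling :: "(nat \<Rightarrow> bool) \<Rightarrow> (nat \<Rightarrow> bool) \<Rightarrow> point \<Rightarrow> bool" where
  "labelling f g (Unprimed i) = f i"
| "labelling f g (Primed i) = g i"

text \<open>The clause outside \<open>{1..n}\<close> mirrors the vertical strands that
  \<open>word_rel\<close> has there, so that the two relations can be equal as functions.\<close>

definition part_rel :: "nat \<Rightarrow> point set set \<Rightarrow> (nat \<Rightarrow> bool) \<Rightarrow> (nat \<Rightarrow> bool) \<Rightarrow> bool" where
  "part_rel n \<alpha> f g \<longleftrightarrow>
     (\<forall>B\<in>\<alpha>. \<forall>x\<in>B. \<forall>y\<in>B. labelling f g x = labelling f g y) \<and> (\<forall>j. j \<notin> {1..n} \<longrightarrow> f j = g j)"

lemma part_rel_block_rel: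
  "part_rel n \<alpha> f g \<longleftrightarrow>
     (\<forall>x y. (x, y) \<in> block_rel \<alpha> \<longrightarrow> labelling f g x = labelling f g y) \<and> (\<forall>j. j \<notin> {1..n} \<longrightarrow> f j = g j)"
  unfolding part_rel_def block_rel_def by blast

lemma block_rel_points: "partition_on (points n) \<alpha> \<Longrightarrow> block_rel \<alpha> \<subseteq> points n \<times> points n"
  unfolding block_rel_def using partition_onD1 by fastforce

section \<open>Gluing of partitions as composition of relations\<close>

lemma equiv_Inter:
  assumes "\<E> \<noteq> {}" "\<And>E. E \<in> \<E> \<Longrightarrow> equiv A E"
  shows "equiv A (\<Inter>\<E>)"
proof (rule equivI)
  show "\<Inter>\<E> \<subseteq> A \<times> A"
    using assms by (blast dest: equiv_type)
  show "refl_on A (\<Inter>\<E>)"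
    using assms by (auto intro!: refl_onI dest: equiv_class_self simp: equiv_def refl_on_def)
  show "sym (\<Inter>\<E>)"
    using assms by (auto intro!: symI simp: equiv_def dest: symD)
  show "trans (\<Inter>\<E>)"
    using assms unfolding equiv_def by (intro transI InterI) (blast dest: transD)
qed

lemma left_factor_points3: "x \<in> points n \<Longrightarrow> left_factor x \<in> points3 n"
  and right_factor_points3: "x \<in> points n \<Longrightarrow> right_factor x \<in> points3 n"
  and outer_points3: "x \<in> points n \<Longrightarrow> outer x \<in> points3 n"
  by (cases x; auto simp: points_def points3_def)+

context
  fixes n :: nat and \<alpha> \<beta> :: "point set set"
  assumes \<alpha>: "partition_on (points n) \<alpha>" and \<beta>: "partition_on (points n) \<beta>"
begin

text \<open>The full relation on the three rows belongs to the family, so the intersection runs over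
  a nonempty set of equivalences.\<close>

lemma equiv_glue: "equiv (points3 n) (glue n \<alpha> \<beta>)"
  unfolding glue_def
proof (rule equiv_Inter)
  have "equiv (points3 n) (points3 n \<times> points3 n)"
    by (auto intro!: equivI refl_onI symI transI)
  moreover have "map_prod left_factor left_factor ` block_rel \<alpha> \<subseteq> points3 n \<times> points3 n"
    using block_rel_points[OF \<alpha>] left_factor_points3 by auto
  moreover have "map_prod right_factor right_factor ` block_rel \<beta> \<subseteq> points3 n \<times> points3 n"
    using block_rel_points[OF \<beta>] right_factor_points3 by auto
  ultimately show "{E. equiv (points3 n) E \<and> map_prod left_factor left_factor ` block_rel \<alpha> \<subseteq> E \<and>
      map_prod right_factor right_factor ` block_rel \<beta> \<subseteq> E} \<noteq> {}"
    by blast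
qed blast

lemma left_factor_glue: "(x, y) \<in> block_rel \<alpha> \<Longrightarrow> (left_factor x, left_factor y) \<in> glue n \<alpha> \<beta>"
  unfolding glue_def by force

lemma right_factor_glue: "(x, y) \<in> block_rel \<beta> \<Longrightarrow> (right_factor x, right_factor y) \<in> glue n \<alpha> \<beta>"
  unfolding glue_def by force

lemma glue_least:
  assumes "equiv (points3 n) E"
    and "\<And>x y. (x, y) \<in> block_rel \<alpha> \<Longrightarrow> (left_factor x, left_factor y) \<in> E"
    and "\<And>x y. (x, y) \<in> block_rel \<beta> \<Longrightarrow> (right_factor x, right_factor y) \<in> E"
  shows "glue n \<alpha> \<beta> \<subseteq> E"
  unfolding glue_def using assms by (intro Inter_lower) auto

abbreviation outer_glue :: "(point \<times> point) set" where
  "outer_glue \<equiv> {(x, y). x \<in> points n \<and> y \<in> points n \<and> (outer x, outer y) \<in> glue n \<alpha> \<beta>}"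

lemma equiv_outer_glue: "equiv (points n) outer_glue"
proof (rule equivI)
  note E = equiv_glue[unfolded equiv_def]
  show "outer_glue \<subseteq> points n \<times> points n" by blast
  show "refl_on (points n) outer_glue"
    using E outer_points3 by (auto intro!: refl_onI dest: refl_onD)
  show "sym outer_glue"
    using E by (auto intro!: symI dest: symD)
  show "trans outer_glue"
    using E by (auto intro!: transI dest: transD)
qed

lemma partition_on_part_mult: "partition_on (points n) (part_mult n \<alpha> \<beta>)"
  unfolding part_mult_def by (rule partition_on_quotient[OF equiv_outer_glue])

lemma part_rel_part_mult_iff:
  "part_rel n (part_mult n \<alpha> \<beta>) f g \<longleftrightarrow>
     (\<forall>x\<in>points n. \<forall>y\<in>points n. (outer x, outer y) \<in> glue n \<alpha> \<beta> \<longrightarrow> labelling f g x = labelling f g y) \<and>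
     (\<forall>j. j \<notin> {1..n} \<longrightarrow> f j = g j)"
proof -
  have "block_rel (part_mult n \<alpha> \<beta>) = outer_glue"
  proof (intro equalityI subrelI)
    fix x y assume "(x, y) \<in> block_rel (part_mult n \<alpha> \<beta>)"
    then obtain B where "B \<in> points n // outer_glue" "x \<in> B" "y \<in> B"
      unfolding block_rel_def part_mult_def by blast
    then show "(x, y) \<in> outer_glue"
      using in_quotient_imp_in_rel[OF equiv_outer_glue] by blast
  next
    fix x y assume xy: "(x, y) \<in> outer_glue"
    then have "x \<in> points n" by blast
    then have "outer_glue `` {x} \<in> points n // outer_glue" "x \<in> outer_glue `` {x}"
      by (rule quotientI, rule equiv_class_self[OF equiv_outer_glue])
    with xy show "(x, y) \<in> block_rel (part_mult n \<alpha> \<beta>)"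
      unfolding block_rel_def part_mult_def by (intro CollectI case_prodI bexI) auto
  qed
  then show ?thesis unfolding part_rel_block_rel by auto
qed

text \<open>Restricting to the outer rows forgets the middle labels. Forwards they are reconstructed
  from the components of the glued diagram; backwards a labelling of all three rows bounds the
  components from above.\<close>

lemma part_rel_part_mult:
  "part_rel n (part_mult n \<alpha> \<beta>) f g \<longleftrightarrow> (\<exists>k. part_rel n \<alpha> f k \<and> part_rel n \<beta> k g)"
proof
  assume L: "part_rel n (part_mult n \<alpha> \<beta>) f g"
  note E = equiv_glue[unfolded equiv_def]
  \<comment> \<open>A component inherits the common label of its outer points; one that lies
    entirely in the middle row gets \<open>False\<close>.\<close>
  define l where "l z \<longleftrightarrow> (\<exists>x\<in>points n. (z, outer x) \<in> glue n \<alpha> \<beta> \<and> labelling f g x)" for z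
  define k where "k j = (if j \<in> {1..n} then l (MiddleRow j) else f j)" for j
  have l_glue: "l z = l z'" if "(z, z') \<in> glue n \<alpha> \<beta>" for z z'
  proof -
    have "(z', z) \<in> glue n \<alpha> \<beta>" using that E by (blast dest: symD)
    then show ?thesis using that E unfolding l_def by (blast dest: transD)
  qed
  have l_outer: "l (outer x) = labelling f g x" if "x \<in> points n" for x
  proof -
    have "(outer x, outer x) \<in> glue n \<alpha> \<beta>"
      using outer_points3[OF that] E by (blast dest: refl_onD)
    then show ?thesis
      using L that unfolding l_def part_rel_part_mult_iff by blast
  qed
  have left: "labelling f k x = l (left_factor x)" if "x \<in> points n" for x
    using l_outer[OF that] that by (cases x) (auto simp: k_def points_def)
  have right: "labelling k g x = l (right_factor x)" if "x \<in> points n" for x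
    using l_outer[OF that] that by (cases x) (auto simp: k_def points_def)
  have out: "f j = k j" "k j = g j" if "j \<notin> {1..n}" for j
    using that L by (auto simp: k_def part_rel_def)
  have "part_rel n \<alpha> f k"
    unfolding part_rel_block_rel
  proof (intro conjI allI impI)
    fix x y assume xy: "(x, y) \<in> block_rel \<alpha>"
    then have "x \<in> points n" "y \<in> points n" using block_rel_points[OF \<alpha>] by auto
    then show "labelling f k x = labelling f k y"
      using l_glue[OF left_factor_glue[OF xy]] by (simp add: left)
  qed (rule out)
  moreover have "part_rel n \<beta> k g"
    unfolding part_rel_block_rel
  proof (intro conjI allI impI)
    fix x y assume xy: "(x, y) \<in> block_rel \<beta>"
    then have "x \<in> points n" "y \<in> points n" using block_rel_points[OF \<beta>] by auto
    then show "labelling k g x = labelling k g y"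
      using l_glue[OF right_factor_glue[OF xy]] by (simp add: right)
  qed (rule out)
  ultimately show "\<exists>k. part_rel n \<alpha> f k \<and> part_rel n \<beta> k g" by blast
next
  assume "\<exists>k. part_rel n \<alpha> f k \<and> part_rel n \<beta> k g"
  then obtain k where k: "part_rel n \<alpha> f k" "part_rel n \<beta> k g" by blast
  define l where "l = (\<lambda>z. case z of LeftRow i \<Rightarrow> f i | MiddleRow i \<Rightarrow> k i | RightRow i \<Rightarrow> g i)"
  \<comment> \<open>The kernel of the three-row labelling is an equivalence containing both factors,
    so by minimality \<open>glue\<close> lies inside it.\<close>
  define E where "E = {(x, y). x \<in> points3 n \<and> y \<in> points3 n \<and> l x = l y}"
  have left: "l (left_factor x) = labelling f k x" for x
    by (cases x) (auto simp: l_def)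
  have right: "l (right_factor x) = labelling k g x" for x
    by (cases x) (auto simp: l_def)
  have outer: "l (outer x) = labelling f g x" for x
    by (cases x) (auto simp: l_def)
  have "equiv (points3 n) E"
    unfolding E_def by (auto intro!: equivI refl_onI symI transI)
  then have "glue n \<alpha> \<beta> \<subseteq> E"
  proof (rule glue_least)
    fix x y assume xy: "(x, y) \<in> block_rel \<alpha>"
    then have "x \<in> points n" "y \<in> points n" using block_rel_points[OF \<alpha>] by auto
    then show "(left_factor x, left_factor y) \<in> E"
      using k(1) xy unfolding E_def part_rel_block_rel by (simp add: left left_factor_points3)
  next
    fix x y assume xy: "(x, y) \<in> block_rel \<beta>"
    then have "x \<in> points n" "y \<in> points n" using block_rel_points[OF \<beta>] by auto
    then show "(right_factor x, right_factor y) \<in> E"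
      using k(2) xy unfolding E_def part_rel_block_rel by (simp add: right right_factor_points3)
  qed
  then have "labelling f g x = labelling f g y" if "(outer x, outer y) \<in> glue n \<alpha> \<beta>" for x y
    using that unfolding E_def outer[symmetric] by blast
  then show "part_rel n (part_mult n \<alpha> \<beta>) f g"
    using k unfolding part_rel_part_mult_iff by (auto simp: part_rel_def)
qed

text \<open>Test with the indicator of the block of \<open>x\<close> in \<alpha>. It is constant on
  the blocks of \<alpha>, hence on those of \<beta>, so a point joined to \<open>x\<close> in
  \<beta> cannot leave that block.\<close>

lemma part_rel_le_imp_block_rel_le:
  assumes "\<And>f g. part_rel n \<alpha> f g \<Longrightarrow> part_rel n \<beta> f g"
  shows "block_rel \<beta> \<subseteq> block_rel \<alpha>"
proof (rule subrelI)
  fix x y assume xy: "(x, y) \<in> block_rel \<beta>"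
  then have "x \<in> points n" using block_rel_points[OF \<beta>] by blast
  then obtain B where B: "B \<in> \<alpha>" "x \<in> B" using partition_onD1[OF \<alpha>] by blast
  define f where "f i \<longleftrightarrow> Unprimed i \<in> B" for i
  define g where "g i \<longleftrightarrow> Primed i \<in> B" for i
  have lab: "labelling f g z \<longleftrightarrow> z \<in> B" for z
    by (cases z) (auto simp: f_def g_def)
  have "z \<in> B \<longleftrightarrow> z' \<in> B" if "A \<in> \<alpha>" "z \<in> A" "z' \<in> A" for A z z'
    using that B(1) disjointD[OF partition_onD2[OF \<alpha>], of A B] by blast
  moreover have "B \<subseteq> points n" using partition_onD1[OF \<alpha>] B by blast
  then have "f j = g j" if "j \<notin> {1..n}" for j
    using that unfolding f_def g_def points_def by blast
  ultimately have "part_rel n \<alpha> f g"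
    unfolding part_rel_def lab by blast
  then have "part_rel n \<beta> f g" by (rule assms)
  then have "y \<in> B" using xy B(2) unfolding part_rel_block_rel lab by blast
  then show "(x, y) \<in> block_rel \<alpha>" using B unfolding block_rel_def by blast
qed

end

lemma part_rel_inject:
  assumes \<alpha>: "partition_on (points n) \<alpha>" and \<beta>: "partition_on (points n) \<beta>"
    and eq: "\<And>f g. part_rel n \<alpha> f g \<longleftrightarrow> part_rel n \<beta> f g"
  shows "\<alpha> = \<beta>"
proof -
  have "block_rel \<alpha> = block_rel \<beta>"
    using part_rel_le_imp_block_rel_le[OF \<alpha> \<beta>] part_rel_le_imp_block_rel_le[OF \<beta> \<alpha>] eq by blast
  moreover have "points n // block_rel \<alpha> = \<alpha>" "points n // block_rel \<beta> = \<beta>"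
    unfolding block_rel_def by (rule partition_on_eq_quotient[OF \<alpha>] partition_on_eq_quotient[OF \<beta>])+
  ultimately show ?thesis by metis
qed

section \<open>The partition belonging to a normal form\<close>

definition normal_part :: "nat \<Rightarrow> nat set set \<Rightarrow> nat set \<Rightarrow> (nat \<Rightarrow> nat) \<Rightarrow> nat set set \<Rightarrow> point set set" where
  "normal_part n u C p v =
     (`) Unprimed ` u \<union> (\<lambda>j. {Unprimed j}) ` (C - \<Union>u) \<union>
     (\<lambda>j. {Unprimed j, Primed (p j)}) ` ({1..n} - C) \<union>
     (`) Primed ` v \<union> (\<lambda>j. {Primed j}) ` (p ` C - \<Union>v)"

lemma normal_part_cases:
  assumes "B \<in> normal_part n u C p v"
  obtains (upper) A where "A \<in> u" "B = Unprimed ` A" | (left) j where "j \<in> C - \<Union>u" "B = {Unprimed j}"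
    | (transversal) j where "j \<in> {1..n} - C" "B = {Unprimed j, Primed (p j)}"
    | (lower) A where "A \<in> v" "B = Primed ` A" | (right) j where "j \<in> p ` C - \<Union>v" "B = {Primed j}"
  using assms unfolding normal_part_def by (elim UnE imageE) (rule that; assumption)+

lemma part_rel_normal_part:
  "part_rel n (normal_part n u C p v) f g \<longleftrightarrow>
     (\<forall>B\<in>u. \<forall>x\<in>B. \<forall>y\<in>B. f x = f y) \<and> (\<forall>B\<in>v. \<forall>x\<in>B. \<forall>y\<in>B. g x = g y) \<and>
     (\<forall>j\<in>{1..n} - C. f j = g (p j)) \<and> (\<forall>j. j \<notin> {1..n} \<longrightarrow> f j = g j)"
proof -
  have pairs: "(\<forall>B\<in>(\<lambda>j. {Unprimed j, Primed (p j)}) ` D. \<forall>x\<in>B. \<forall>y\<in>B. labelling f g x = labelling f g y) \<longleftrightarrow>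
      (\<forall>j\<in>D. f j = g (p j))" for D
  proof -
    have "(\<forall>x\<in>{Unprimed j, Primed k}. \<forall>y\<in>{Unprimed j, Primed k}. labelling f g x = labelling f g y) \<longleftrightarrow> f j = g k" for j k
      by auto
    then show ?thesis by simp
  qed
  show ?thesis
    unfolding part_rel_def normal_part_def ball_Un pairs by (simp add: conj_ac)
qed

context
  fixes n u C p v
  assumes C: "C \<subseteq> {1..n::nat}" and p: "p permutes {1..n}" and u: "hooks C u" and v: "hooks (p ` C) v"
begin

lemma partition_on_normal_part: "partition_on (points n) (normal_part n u C p v)"
proof (rule partition_onI)
  have pC: "p ` C \<subseteq> {1..n}" using image_mono[OF C, of p] unfolding permutes_image[OF p] .
  have pD: "p ` ({1..n} - C) = {1..n} - p ` C"
    using permutes_image[OF p] image_set_diff[OF permutes_inj[OF p], of "{1..n}" C] by simp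
  have uC: "\<Union>u \<subseteq> C" "\<Union>v \<subseteq> p ` C" using hooksD(2)[OF u] hooksD(2)[OF v] by blast+
  have "\<Union>(normal_part n u C p v) =
      Unprimed ` (\<Union>u \<union> (C - \<Union>u) \<union> ({1..n} - C)) \<union> Primed ` (p ` ({1..n} - C) \<union> \<Union>v \<union> (p ` C - \<Union>v))"
    unfolding normal_part_def by (auto simp: image_iff)
  also have "\<dots> = points n"
  proof -
    have "\<Union>u \<union> (C - \<Union>u) \<union> ({1..n} - C) = {1..n}" "{1..n} - p ` C \<union> \<Union>v \<union> (p ` C - \<Union>v) = {1..n}"
      using uC C pC by blast+
    then show ?thesis unfolding pD points_def by simp
  qed
  finally show "\<Union>(normal_part n u C p v) = points n" .
  show "{} \<notin> normal_part n u C p v"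
    using hooksD(1)[OF u] hooksD(1)[OF v] unfolding normal_part_def by force
  \<comment> \<open>Disjointness is proved by recovering a block from any one of its points. For a
    point on no hook the union is empty, and \<open>insert x\<close> leaves the singleton.\<close>
  define block where "block x = (case x of
      Unprimed i \<Rightarrow> if i \<notin> C then {Unprimed i, Primed (p i)} else insert x (Unprimed ` \<Union>{B\<in>u. i \<in> B})
    | Primed i \<Rightarrow> if i \<notin> p ` C then {Unprimed (inv p i), Primed i} else insert x (Primed ` \<Union>{B\<in>v. i \<in> B}))" for x
  have *: "B = block x" if B: "B \<in> normal_part n u C p v" and x: "x \<in> B" for B x
  proof -
    from B show ?thesis
    proof (cases rule: normal_part_cases)
      case (upper A)
      then obtain i where i: "i \<in> A" "x = Unprimed i" using x by blast
      have "B' = A" if "B' \<in> u" "i \<in> B'" for B'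
        using hooksD(3)[OF u that(1) upper(1)] that(2) i(1) by blast
      then have "{B\<in>u. i \<in> B} = {A}" using upper i by blast
      moreover have "i \<in> C" using i upper uC by blast
      ultimately show ?thesis using i upper by (simp add: block_def insert_absorb)
    next
      case (left j)
      then show ?thesis using x by (auto simp: block_def)
    next
      case (transversal j)
      then have "p j \<notin> p ` C" using inj_image_mem_iff[OF permutes_inj[OF p], of j C] by blast
      then show ?thesis using transversal x permutes_inverses[OF p] by (auto simp: block_def)
    next
      case (lower A)
      then obtain i where i: "i \<in> A" "x = Primed i" using x by blast
      have "B' = A" if "B' \<in> v" "i \<in> B'" for B'
        using hooksD(3)[OF v that(1) lower(1)] that(2) i(1) by blast
      then have "{B\<in>v. i \<in> B} = {A}" using lower i by blast
      moreover have "i \<in> p ` C" using i lower uC by blast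
      ultimately show ?thesis using i lower by (simp add: block_def insert_absorb)
    next
      case (right j)
      then show ?thesis using x by (auto simp: block_def)
    qed
  qed
  fix A B assume AB: "A \<in> normal_part n u C p v" "B \<in> normal_part n u C p v" "A \<noteq> B"
  show "disjnt A B"
    unfolding disjnt_iff using *[OF AB(1)] *[OF AB(2)] AB(3) by metis
qed

lemma card_image_Unprimed: "card (Unprimed ` A) = card A"
  and card_image_Primed: "card (Primed ` A) = card A"
  by (simp_all add: card_image inj_on_def)

lemma card_normal_part:
  assumes "B \<in> normal_part n u C p v"
  shows "card B \<le> 2"
  using assms
proof (cases rule: normal_part_cases)
  case (upper A)
  then show ?thesis using hooksD(1)[OF u upper(1)] by (simp add: card_image_Unprimed)
next
  case (lower A)
  then show ?thesis using hooksD(1)[OF v lower(1)] by (simp add: card_image_Primed)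
qed simp_all

text \<open>With the two lemmas that follow, the partition determines \<open>u\<close>,
  \<open>v\<close>, the complement of \<open>C\<close> and \<open>p\<close> on it. Cardinality 2
  keeps hooks apart from singleton blocks.\<close>

lemma Unprimed_in_normal_part:
  assumes "card B = 2"
  shows "Unprimed ` B \<in> normal_part n u C p v \<longleftrightarrow> B \<in> u"
proof
  assume "Unprimed ` B \<in> normal_part n u C p v"
  then show "B \<in> u"
  proof (cases rule: normal_part_cases)
    case (upper A)
    moreover have "inj Unprimed" by (auto intro: injI)
    ultimately show ?thesis by (simp add: inj_image_eq_iff)
  next
    case (left j)
    then show ?thesis using card_image_Unprimed[of B] assms by simp
  next
    case (transversal j)
    then have "Primed (p j) \<in> Unprimed ` B" by simp
    then show ?thesis by blast
  next
    case (lower A)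
    have "B \<noteq> {}" using assms by auto
    then show ?thesis using lower by blast
  next
    case (right j)
    then have "Primed j \<in> Unprimed ` B" by simp
    then show ?thesis by blast
  qed
qed (auto simp: normal_part_def)

lemma Primed_in_normal_part:
  assumes "card B = 2"
  shows "Primed ` B \<in> normal_part n u C p v \<longleftrightarrow> B \<in> v"
proof
  assume "Primed ` B \<in> normal_part n u C p v"
  then show "B \<in> v"
  proof (cases rule: normal_part_cases)
    case (lower A)
    moreover have "inj Primed" by (auto intro: injI)
    ultimately show ?thesis by (simp add: inj_image_eq_iff)
  next
    case (right j)
    then show ?thesis using card_image_Primed[of B] assms by simp
  next
    case (transversal j)
    then have "Unprimed j \<in> Primed ` B" by simp
    then show ?thesis by blast
  next
    case (upper A)
    have "B \<noteq> {}" using assms by auto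
    then show ?thesis using upper by blast
  next
    case (left j)
    then have "Unprimed j \<in> Primed ` B" by simp
    then show ?thesis by blast
  qed
qed (auto simp: normal_part_def)

lemma transversal_in_normal_part:
  "{Unprimed j, Primed k} \<in> normal_part n u C p v \<longleftrightarrow> j \<in> {1..n} - C \<and> k = p j"
proof
  assume "{Unprimed j, Primed k} \<in> normal_part n u C p v"
  then show "j \<in> {1..n} - C \<and> k = p j"
  proof (cases rule: normal_part_cases)
    case (upper A)
    then have "Primed k \<in> Unprimed ` A" by auto
    then show ?thesis by blast
  next
    case (lower A)
    then have "Unprimed j \<in> Primed ` A" by auto
    then show ?thesis by blast
  qed (simp_all add: doubleton_eq_iff)
qed (simp add: normal_part_def)

end

section \<open>Partitions of normal forms\<close>


context PB_rep
begin

text \<open>One and the same word must witness the value and the relation. This couples them inside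
  an arbitrary model, where it is not yet known that the value determines the relation.\<close>

definition represents :: "'m \<Rightarrow> ((nat \<Rightarrow> bool) \<Rightarrow> (nat \<Rightarrow> bool) \<Rightarrow> bool) \<Rightarrow> bool" where
  "represents x R \<longleftrightarrow> (\<exists>w\<in>lists (PB_gens n). prod_list (map val w) = x \<and> word_rel w = R)"

lemma represents_mult:
  assumes "represents x R" "represents y S"
  shows "represents (x * y) (R OO S)"
proof -
  obtain u v where uv: "u \<in> lists (PB_gens n)" "prod_list (map val u) = x" "word_rel u = R"
    "v \<in> lists (PB_gens n)" "prod_list (map val v) = y" "word_rel v = S"
    using assms unfolding represents_def by blast
  have "word_rel (u @ v) = R OO S"
    using uv by (auto simp: fun_eq_iff word_rel_append relcompp_apply)
  then show ?thesis
    unfolding represents_def using uv by (intro bexI[of _ "u @ v"]) auto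
qed

lemma represents_cong:
  assumes "represents x R" "\<And>f g. R f g \<longleftrightarrow> S f g"
  shows "represents x S"
proof -
  have "R = S" using assms(2) by (intro ext)
  then show ?thesis using assms(1) by simp
qed

lemma represents_1: "represents 1 (=)"
  unfolding represents_def by (intro bexI[of _ "[]"]) (auto simp: fun_eq_iff)

lemma represents_gen: "g \<in> PB_gens n \<Longrightarrow> represents (val g) (word_rel [g])"
  unfolding represents_def by (intro bexI[of _ "[g]"]) auto

lemma represents_e: "a \<in> {1..n} \<Longrightarrow> represents (e a) (\<lambda>f g. \<forall>x. x \<noteq> a \<longrightarrow> f x = g x)"
  by (rule represents_cong[OF represents_gen word_rel_singleton(3)]) (auto simp: PB_gens_def)

lemma represents_h: "perm p \<Longrightarrow> represents (h p) (\<lambda>f g. f = g \<circ> p)"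
proof (induction p rule: permutes_adjacent_induct)
  case id
  have "represents 1 (\<lambda>f g. f = g \<circ> id)"
    by (rule represents_cong[OF represents_1]) simp
  then show ?case unfolding h_id .
next
  case (comp p i)
  have i: "i \<in> {1..<n}" using comp.hyps by auto
  then have "\<sigma> i \<in> PB_gens n" by (auto simp: PB_gens_def)
  have "represents (s i * h p) (\<lambda>f g. f = g \<circ> (p \<circ> transpose i (Suc i)))"
  proof (rule represents_cong[OF represents_mult[OF represents_gen[OF \<open>\<sigma> i \<in> _\<close>] comp.IH]])
    fix f g :: "nat \<Rightarrow> bool"
    have "f \<circ> transpose i (Suc i) = g \<circ> p \<longleftrightarrow> f = g \<circ> (p \<circ> transpose i (Suc i))"
    proof
      assume "f \<circ> transpose i (Suc i) = g \<circ> p"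
      then have "f \<circ> transpose i (Suc i) \<circ> transpose i (Suc i) = g \<circ> p \<circ> transpose i (Suc i)" by simp
      then show "f = g \<circ> (p \<circ> transpose i (Suc i))" by (simp only: comp_assoc transpose_comp_involutory comp_id)
    next
      assume "f = g \<circ> (p \<circ> transpose i (Suc i))"
      then show "f \<circ> transpose i (Suc i) = g \<circ> p" by (simp only: comp_assoc transpose_comp_involutory comp_id)
    qed
    then show "(word_rel [\<sigma> i] OO (\<lambda>f g. f = g \<circ> p)) f g \<longleftrightarrow> f = g \<circ> (p \<circ> transpose i (Suc i))"
      by (simp add: relcompp_apply word_rel.simps)
  qed
  then show ?case
    unfolding h_adjacent[OF comp.hyps(1) i, symmetric] by (simp add: comp_def)
qed simp

text \<open>Written as a conjugate of \<open>t 1\<close>, the hook has the relation of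
  \<open>\<theta> 1\<close> with both labellings precomposed with \<open>q\<close>; the places 1 and
  2 thereby become \<open>a\<close> and \<open>b\<close>.\<close>

lemma represents_hook_elt:
  assumes "B \<subseteq> {1..n}" "card B = 2"
  shows "represents (hook_elt B)
    (\<lambda>f g. (\<forall>x\<in>B. \<forall>y\<in>B. f x = f y) \<and> (\<forall>x\<in>B. \<forall>y\<in>B. g x = g y) \<and> (\<forall>x. x \<notin> B \<longrightarrow> f x = g x))"
proof -
  obtain a b where B: "B = {a, b}" "a \<noteq> b" using assms(2) unfolding card_2_iff by blast
  then have ab: "a \<in> {1..n}" "b \<in> {1..n}" using assms(1) by auto
  obtain q where q: "perm q" "q 1 = a" "q 2 = b" "n \<ge> 2" using ex_perm2[OF ab B(2)] .
  have elt: "hook_elt B = h (inv q) * t 1 * h q"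
    using hook_elt_pair[OF ab B(2)] conj_t1[OF q(4,1)] q(2,3) B(1) by (simp add: conj_def)
  have "\<theta> 1 \<in> PB_gens n" using q(4) by (auto simp: PB_gens_def)
  have num: "Suc 1 = 2" by simp
  show ?thesis unfolding elt
  proof (rule represents_cong[OF represents_mult[OF represents_mult[OF represents_h[OF permutes_inv[OF q(1)]]
          represents_gen[OF \<open>\<theta> 1 \<in> _\<close>]] represents_h[OF q(1)]]])
    fix f g :: "nat \<Rightarrow> bool"
    have "(\<forall>x. x \<notin> B \<longrightarrow> f x = g x) \<longleftrightarrow> (\<forall>x. q x \<notin> B \<longrightarrow> f (q x) = g (q x))"
      using permutes_inverses(1)[OF q(1)] by metis
    also have "\<dots> \<longleftrightarrow> (\<forall>x. x \<noteq> 1 \<longrightarrow> x \<noteq> 2 \<longrightarrow> f (q x) = g (q x))"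
      unfolding B q(2,3)[symmetric] using inj_eq[OF permutes_inj[OF q(1)]] by (simp add: imp_conjL)
    finally have rest: "(\<forall>x. x \<noteq> 1 \<longrightarrow> x \<noteq> 2 \<longrightarrow> f (q x) = g (q x)) \<longleftrightarrow> (\<forall>x. x \<notin> B \<longrightarrow> f x = g x)" ..
    have "((\<lambda>f g. f = g \<circ> inv q) OO word_rel [\<theta> 1]) OO (\<lambda>f g. f = g \<circ> q) =
        (\<lambda>f g. word_rel [\<theta> 1] (f \<circ> q) (g \<circ> q))"
    proof (intro ext)
      fix f g :: "nat \<Rightarrow> bool"
      have k: "f = k \<circ> inv q \<longleftrightarrow> k = f \<circ> q" for k :: "nat \<Rightarrow> bool"
        using permutes_inv_o[OF q(1)] by (auto simp: comp_assoc)
      show "(((\<lambda>f g. f = g \<circ> inv q) OO word_rel [\<theta> 1]) OO (\<lambda>f g. f = g \<circ> q)) f g \<longleftrightarrow>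
          word_rel [\<theta> 1] (f \<circ> q) (g \<circ> q)"
        unfolding relcompp_apply k by blast
    qed
    then have "(((\<lambda>f g. f = g \<circ> inv q) OO word_rel [\<theta> 1]) OO (\<lambda>f g. f = g \<circ> q)) f g \<longleftrightarrow>
        word_rel [\<theta> 1] (f \<circ> q) (g \<circ> q)" by simp
    also have "\<dots> \<longleftrightarrow> f a = f b \<and> g a = g b \<and> (\<forall>x. x \<notin> B \<longrightarrow> f x = g x)"
      unfolding word_rel_singleton num comp_apply q(2,3) rest ..
    also have "\<dots> \<longleftrightarrow> (\<forall>x\<in>B. \<forall>y\<in>B. f x = f y) \<and> (\<forall>x\<in>B. \<forall>y\<in>B. g x = g y) \<and> (\<forall>x. x \<notin> B \<longrightarrow> f x = g x)"
      unfolding B by auto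
    finally show "(((\<lambda>f g. f = g \<circ> inv q) OO word_rel [\<theta> 1]) OO (\<lambda>f g. f = g \<circ> q)) f g \<longleftrightarrow>
        (\<forall>x\<in>B. \<forall>y\<in>B. f x = f y) \<and> (\<forall>x\<in>B. \<forall>y\<in>B. g x = g y) \<and> (\<forall>x. x \<notin> B \<longrightarrow> f x = g x)" .
  qed
qed

lemma represents_E:
  assumes "C \<subseteq> {1..n}"
  shows "represents (E C) (\<lambda>f g. \<forall>x. x \<notin> C \<longrightarrow> f x = g x)"
  using finite_subset[OF assms finite_atLeastAtMost] assms
proof (induction C rule: finite_induct)
  case empty
  show ?case unfolding cprod_empty
    by (rule represents_cong[OF represents_1]) (simp add: fun_eq_iff)
next
  case (insert a C)
  have C: "C \<subseteq> {1..n}" and a: "a \<in> {1..n}" using insert.prems by auto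
  show ?case unfolding E_insert[OF C a]
  proof (rule represents_cong[OF represents_mult[OF insert.IH[OF C] represents_e[OF a]]])
    fix f g :: "nat \<Rightarrow> bool"
    show "((\<lambda>f g. \<forall>x. x \<notin> C \<longrightarrow> f x = g x) OO (\<lambda>f g. \<forall>x. x \<noteq> a \<longrightarrow> f x = g x)) f g \<longleftrightarrow>
        (\<forall>x. x \<notin> insert a C \<longrightarrow> f x = g x)"
    proof
      assume "\<forall>x. x \<notin> insert a C \<longrightarrow> f x = g x"
      \<comment> \<open>Intermediate labelling: everything on \<open>C\<close> has already its final
        label, while \<open>a\<close> still carries its initial one.\<close>
      then have "\<forall>x. x \<notin> C \<longrightarrow> f x = (g(a := f a)) x" "\<forall>x. x \<noteq> a \<longrightarrow> (g(a := f a)) x = g x" by auto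
      then show "((\<lambda>f g. \<forall>x. x \<notin> C \<longrightarrow> f x = g x) OO (\<lambda>f g. \<forall>x. x \<noteq> a \<longrightarrow> f x = g x)) f g"
        unfolding relcompp_apply by blast
    qed (auto simp: relcompp_apply)
  qed
qed

lemma represents_Th:
  assumes "hooks_in u"
  shows "represents (Th u) (\<lambda>f g. (\<forall>B\<in>u. \<forall>x\<in>B. \<forall>y\<in>B. f x = f y) \<and> (\<forall>B\<in>u. \<forall>x\<in>B. \<forall>y\<in>B. g x = g y) \<and>
    (\<forall>x. x \<notin> \<Union>u \<longrightarrow> f x = g x))"
  using hooks_in_finite[OF assms] assms
proof (induction u rule: finite_induct)
  case empty
  show ?case unfolding cprod_empty
    by (rule represents_cong[OF represents_1]) (simp add: fun_eq_iff)
next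
  case (insert B u)
  have hooks: "hooks {1..n} (insert B u)" using insert.prems unfolding hooks_in_def .
  have u: "hooks_in u"
    unfolding hooks_in_def by (rule hooks_mono[OF hooks]) auto
  have B: "B \<subseteq> {1..n}" "card B = 2" using hooksD(1,2)[OF hooks insertI1] by auto
  have disj: "A \<inter> B = {}" if "A \<in> u" for A
    using hooksD(3)[OF hooks, of A B] that insert.hyps(2) by blast
  show ?case unfolding Th_insert(1)[OF insert.prems insert.hyps(2)]
  proof (rule represents_cong[OF represents_mult[OF represents_hook_elt[OF B] insert.IH[OF u]]], unfold relcompp_apply)
    fix f g :: "nat \<Rightarrow> bool"
    show "(\<exists>k. ((\<forall>x\<in>B. \<forall>y\<in>B. f x = f y) \<and> (\<forall>x\<in>B. \<forall>y\<in>B. k x = k y) \<and> (\<forall>x. x \<notin> B \<longrightarrow> f x = k x)) \<and>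
          (\<forall>B\<in>u. \<forall>x\<in>B. \<forall>y\<in>B. k x = k y) \<and> (\<forall>B\<in>u. \<forall>x\<in>B. \<forall>y\<in>B. g x = g y) \<and> (\<forall>x. x \<notin> \<Union>u \<longrightarrow> k x = g x)) \<longleftrightarrow>
        (\<forall>B\<in>insert B u. \<forall>x\<in>B. \<forall>y\<in>B. f x = f y) \<and> (\<forall>B\<in>insert B u. \<forall>x\<in>B. \<forall>y\<in>B. g x = g y) \<and>
          (\<forall>x. x \<notin> \<Union>(insert B u) \<longrightarrow> f x = g x)" (is "(\<exists>k. ?P k) \<longleftrightarrow> ?Q")
    proof
      assume "\<exists>k. ?P k"
      then obtain k where k: "\<forall>x\<in>B. \<forall>y\<in>B. f x = f y" "\<forall>x\<in>B. \<forall>y\<in>B. k x = k y" "\<forall>x. x \<notin> B \<longrightarrow> f x = k x"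
        "\<forall>B\<in>u. \<forall>x\<in>B. \<forall>y\<in>B. k x = k y" "\<forall>B\<in>u. \<forall>x\<in>B. \<forall>y\<in>B. g x = g y" "\<forall>x. x \<notin> \<Union>u \<longrightarrow> k x = g x"
        by (elim exE conjE) (rule that; assumption)
      have fk: "f x = k x" if "A \<in> u" "x \<in> A" for A x
        using that disj[OF that(1)] k(3) by blast
      have kg: "k x = g x" if "x \<in> B" for x
        using that disj k(6) by (metis IntI UnionE empty_iff)
      have "\<forall>A\<in>u. \<forall>x\<in>A. \<forall>y\<in>A. f x = f y"
      proof (intro ballI)
        fix A x y assume A: "A \<in> u" "x \<in> A" "y \<in> A"
        then have "k x = k y" using k(4) by blast
        then show "f x = f y" unfolding fk[OF A(1,2)] fk[OF A(1,3)] .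
      qed
      moreover have "\<forall>x\<in>B. \<forall>y\<in>B. g x = g y"
      proof (intro ballI)
        fix x y assume xy: "x \<in> B" "y \<in> B"
        then have "k x = k y" using k(2) by blast
        then show "g x = g y" unfolding kg[OF xy(1)] kg[OF xy(2)] .
      qed
      moreover have "\<forall>x. x \<notin> \<Union>(insert B u) \<longrightarrow> f x = g x" using k(3,6) by simp
      ultimately show ?Q unfolding ball_simps(7) using k(1,5) by (intro conjI)
    next
      assume ?Q
      then have Q: "\<forall>x\<in>B. \<forall>y\<in>B. f x = f y" "\<forall>A\<in>u. \<forall>x\<in>A. \<forall>y\<in>A. f x = f y"
        "\<forall>x\<in>B. \<forall>y\<in>B. g x = g y" "\<forall>A\<in>u. \<forall>x\<in>A. \<forall>y\<in>A. g x = g y"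
        "\<forall>x. x \<notin> \<Union>(insert B u) \<longrightarrow> f x = g x"
        unfolding ball_simps(7) by - (elim conjE, assumption)+
      \<comment> \<open>After the hook \<open>B\<close> has acted, the points of \<open>B\<close>
        carry their final labels and all others their initial ones; since \<open>B\<close> meets no
        hook of \<open>u\<close>, the remaining conditions are unaffected.\<close>
      define k where "k x = (if x \<in> B then g x else f x)" for x
      have kB: "k x = g x" if "x \<in> B" for x using that by (simp add: k_def)
      have ku: "k x = f x" if "A \<in> u" "x \<in> A" for A x
      proof -
        have "x \<notin> B" using that disj[OF that(1)] by blast
        then show ?thesis by (simp add: k_def)
      qed
      have "\<forall>A\<in>u. \<forall>x\<in>A. \<forall>y\<in>A. k x = k y"
      proof (intro ballI)
        fix A x y assume A: "A \<in> u" "x \<in> A" "y \<in> A"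
        then have "f x = f y" using Q(2) by blast
        then show "k x = k y" unfolding ku[OF A(1,2)] ku[OF A(1,3)] .
      qed
      moreover have "\<forall>x\<in>B. \<forall>y\<in>B. k x = k y"
      proof (intro ballI)
        fix x y assume xy: "x \<in> B" "y \<in> B"
        then have "g x = g y" using Q(3) by blast
        then show "k x = k y" unfolding kB[OF xy(1)] kB[OF xy(2)] .
      qed
      moreover have "\<forall>x. x \<notin> B \<longrightarrow> f x = k x" by (simp add: k_def)
      moreover have "\<forall>x. x \<notin> \<Union>u \<longrightarrow> k x = g x" using Q(5) by (simp add: k_def)
      ultimately have "?P k" using Q(1,4) by (intro conjI)
      then show "\<exists>k. ?P k" by (rule exI[of _ k])
    qed
  qed
qed

lemma represents_normal_form:
  assumes "valid u C p v"
  shows "represents (normal_form u C p v) (part_rel n (normal_part n u C p v))"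
proof -
  note V = validD[OF assms]
  have uC: "\<Union>u \<subseteq> C" and vC: "\<Union>v \<subseteq> p ` C"
    using hooksD(2)[OF V(3)] hooksD(2)[OF V(4)] by blast+
  have pC: "p j \<notin> p ` C" if "j \<notin> C" for j
    using that inj_image_mem_iff[OF permutes_inj[OF V(2)]] by blast
  have rest: "(\<forall>j. j \<notin> C \<longrightarrow> f j = g (p j)) \<longleftrightarrow>
      (\<forall>j\<in>{1..n} - C. f j = g (p j)) \<and> (\<forall>j. j \<notin> {1..n} \<longrightarrow> f j = g j)" for f g :: "nat \<Rightarrow> bool"
    using V(1) permutes_not_in[OF V(2)] by (metis DiffD1 DiffD2 DiffI subsetD)
  show ?thesis unfolding normal_form_def
  proof (rule represents_cong[OF represents_mult[OF represents_Th[OF V(6)] represents_mult[OF represents_E[OF V(1)]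
          represents_mult[OF represents_h[OF V(2)] represents_Th[OF V(7)]]]]],
      unfold relcompp_apply part_rel_normal_part)
    fix f g :: "nat \<Rightarrow> bool"
    let ?T = "\<lambda>w f g. (\<forall>B\<in>w. \<forall>x\<in>B. \<forall>y\<in>B. f x = f y) \<and> (\<forall>B\<in>w. \<forall>x\<in>B. \<forall>y\<in>B. g x = g y) \<and>
      (\<forall>x. x \<notin> \<Union>w \<longrightarrow> f x = g x)"
    let ?f = "\<forall>B\<in>u. \<forall>x\<in>B. \<forall>y\<in>B. f x = f y" and ?g = "\<forall>B\<in>v. \<forall>x\<in>B. \<forall>y\<in>B. g x = g y"
    have "(\<exists>k. ?T u f k \<and> (\<exists>l. (\<forall>x. x \<notin> C \<longrightarrow> k x = l x) \<and> (\<exists>m. l = m \<circ> p \<and> ?T v m g))) \<longleftrightarrow>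
        ?f \<and> ?g \<and> (\<forall>j. j \<notin> C \<longrightarrow> f j = g (p j))" (is "?L \<longleftrightarrow> ?R")
    proof
      assume ?L
      then obtain k l m where k: "?T u f k" and l: "\<forall>x. x \<notin> C \<longrightarrow> k x = l x" "l = m \<circ> p" and m: "?T v m g"
        by (elim exE conjE) (rule that; (intro conjI)?; assumption)
      have "f j = g (p j)" if "j \<notin> C" for j
      proof -
        have "\<forall>x. x \<notin> \<Union>u \<longrightarrow> f x = k x" using k by (elim conjE)
        then have "f j = k j" using that uC by blast
        also have "\<dots> = m (p j)" using l that by simp
        also have "\<forall>x. x \<notin> \<Union>v \<longrightarrow> m x = g x" using m by (elim conjE)
        then have "m (p j) = g (p j)" using pC[OF that] vC by blast
        finally show ?thesis .
      qed
      then show ?R using k m by (elim conjE) (intro conjI allI impI; assumption?; blast)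
    next
      assume R: ?R
      then have R': "?f" "?g" "\<forall>x. x \<notin> C \<longrightarrow> f x = (g \<circ> p) x"
        unfolding comp_apply by - (elim conjE, assumption)+
      \<comment> \<open>The hook layers can always leave a labelling that is constant on their hooks
        unchanged. The intermediate rows are therefore \<open>f\<close>, \<open>g \<circ> p\<close>
        and \<open>g\<close>; all changes of labels happen at the \<vartheta>'s on
        \<open>C\<close>.\<close>
      have "?T v g g"
        by (rule conjI[OF R'(2) conjI[OF R'(2)]]) simp
      then have "\<exists>m. g \<circ> p = m \<circ> p \<and> ?T v m g" by - (rule exI[of _ g], rule conjI[OF HOL.refl])
      with R'(3) have "\<exists>l. (\<forall>x. x \<notin> C \<longrightarrow> f x = l x) \<and> (\<exists>m. l = m \<circ> p \<and> ?T v m g)"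
        by - (rule exI[of _ "g \<circ> p"], rule conjI)
      moreover have "?T u f f"
        by (rule conjI[OF R'(1) conjI[OF R'(1)]]) simp
      ultimately show ?L by - (rule exI[of _ f], rule conjI)
    qed
    then show "(\<exists>k. ?T u f k \<and> (\<exists>l. (\<forall>x. x \<notin> C \<longrightarrow> k x = l x) \<and> (\<exists>m. l = m \<circ> p \<and> ?T v m g))) \<longleftrightarrow>
        ?f \<and> ?g \<and> (\<forall>j\<in>{1..n} - C. f j = g (p j)) \<and> (\<forall>j. j \<notin> {1..n} \<longrightarrow> f j = g j)"
      unfolding rest .
  qed
qed

lemma normal_form_eqI:
  assumes "valid u C p v" "valid u' C' p' v'" "normal_part n u C p v = normal_part n u' C' p' v'"
  shows "normal_form u C p v = normal_form u' C' p' v'"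
proof -
  note V = validD[OF assms(1)] and V' = validD[OF assms(2)]
  have "B \<in> u \<longleftrightarrow> B \<in> u'" for B
    using Unprimed_in_normal_part[OF V(1-4), of B] Unprimed_in_normal_part[OF V'(1-4), of B]
      hooksD(1)[OF V(3), of B] hooksD(1)[OF V'(3), of B] assms(3) by metis
  then have u: "u = u'" by blast
  have "B \<in> v \<longleftrightarrow> B \<in> v'" for B
    using Primed_in_normal_part[OF V(1-4), of B] Primed_in_normal_part[OF V'(1-4), of B]
      hooksD(1)[OF V(4), of B] hooksD(1)[OF V'(4), of B] assms(3) by metis
  then have v: "v = v'" by blast
  have tr: "j \<in> {1..n} - C \<and> k = p j \<longleftrightarrow> j \<in> {1..n} - C' \<and> k = p' j" for j k
    using transversal_in_normal_part[OF V(1-4), of j k] transversal_in_normal_part[OF V'(1-4), of j k] assms(3) by metis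
  then have "{1..n} - C = {1..n} - C'" by blast
  then have C: "C = C'" using V(1) V'(1) by blast
  have "p j = p' j" if "j \<in> {1..n} - C" for j using tr[of j "p j"] that by blast
  then have "E C * h p = E C * h p'" using V(1,2) V'(2) by (intro E_h_cong)
  then show ?thesis
    unfolding normal_form_def u[symmetric] v[symmetric] C[symmetric] by (simp flip: mult.assoc)
qed

end

section \<open>The isomorphism\<close>

text \<open>
  The presented monoid embeds into the type of transformations of its elements via the right regular
  representation. Products are composed in reverse because the action is on the right.
\<close>

datatype 'a transf = Transf (app: "'a \<Rightarrow> 'a")
instantiation transf :: (type) monoid_mult
begin
definition "1 = Transf id"
definition "f * g = Transf (app g \<circ> app f)"
instance by standard (auto simp: one_transf_def times_transf_def)
end


lemma PB_rels_lists: "(u, v) \<in> PB_rels n \<Longrightarrow> u \<in> lists (PB_gens n) \<and> v \<in> lists (PB_gens n)"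
  by (induction rule: PB_rels.induct) (simp_all add: PB_gens_def image_iff)

text \<open>The identity outside the carrier makes the action total and lets equality of
  transformations be tested on classes of words only.\<close>

definition T_action :: "nat \<Rightarrow> gen \<Rightarrow> gen list set transf" where
  "T_action n g = Transf (\<lambda>X. if X \<in> carrier (T_monoid n) then X \<otimes>\<^bsub>T_monoid n\<^esub> T_gen n g else X)"

abbreviation T_class :: "nat \<Rightarrow> gen list \<Rightarrow> gen list set" where
  "T_class n \<equiv> word_class (PB_gens n) (PB_rels n)"

lemma T_class_carrier: "u \<in> lists (PB_gens n) \<Longrightarrow> T_class n u \<in> carrier (T_monoid n)"
  unfolding carrier_presented_monoid by (rule imageI)

lemma T_action_class:
  assumes "u \<in> lists (PB_gens n)" "w \<in> lists (PB_gens n)"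
  shows "app (prod_list (map (T_action n) w)) (T_class n u) = T_class n (u @ w)"
  using assms(2,1)
proof (induction w arbitrary: u)
  case Nil
  show ?case by (simp add: one_transf_def)
next
  case (Cons g w)
  have g: "[g] \<in> lists (PB_gens n)" and ug: "u @ [g] \<in> lists (PB_gens n)" using Cons by auto
  have "app (T_action n g) (T_class n u) = T_class n (u @ [g])"
    using mult_presented_monoid[OF Cons.prems g] T_class_carrier[OF Cons.prems] by (simp add: T_action_def)
  then show ?case using Cons.IH[OF ug] by (simp add: times_transf_def)
qed

lemma T_action_outside: "X \<notin> carrier (T_monoid n) \<Longrightarrow> app (prod_list (map (T_action n) w)) X = X"
proof (induction w)
  case Nil
  show ?case by (simp add: one_transf_def)
next
  case (Cons g w)
  then show ?case by (simp add: times_transf_def T_action_def)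
qed

lemma T_class_cong: "(u, v) \<in> pres_cong (PB_gens n) (PB_rels n) \<Longrightarrow> T_class n u = T_class n v"
  unfolding word_class_def by (rule equiv_class_eq[OF equiv_pres_cong])

lemma PB_rep_T_action: "PB_rep n (T_action n)"
proof
  fix u v assume uv: "(u, v) \<in> PB_rels n"
  then have l: "u \<in> lists (PB_gens n)" "v \<in> lists (PB_gens n)" using PB_rels_lists by blast+
  have "app (prod_list (map (T_action n) u)) X = app (prod_list (map (T_action n) v)) X" for X
  proof (cases "X \<in> carrier (T_monoid n)")
    case True
    then obtain w where w: "w \<in> lists (PB_gens n)" "X = T_class n w"
      unfolding carrier_presented_monoid by blast
    have "(w @ u, w @ v) \<in> pres_cong (PB_gens n) (PB_rels n)"
      by (rule pres_cong.mult[OF pres_cong.refl[OF w(1)] pres_cong.rel[OF uv l]])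
    then show ?thesis
      unfolding w(2) T_action_class[OF w(1) l(1)] T_action_class[OF w(1) l(2)] by (rule T_class_cong)
  qed (simp add: T_action_outside)
  then show "prod_list (map (T_action n) u) = prod_list (map (T_action n) v)"
    by (metis ext transf.expand)
qed

text \<open>Applied to the class of the empty word, the action of a word returns the class of that
  word.\<close>

lemma T_action_faithful:
  assumes "u \<in> lists (PB_gens n)" "v \<in> lists (PB_gens n)"
    and "prod_list (map (T_action n) u) = prod_list (map (T_action n) v)"
  shows "(u, v) \<in> pres_cong (PB_gens n) (PB_rels n)"
proof -
  have "T_class n u = T_class n v"
    using T_action_class[of "[]" n u] T_action_class[of "[]" n v] assms by simp
  then show ?thesis using word_class_eq_iff[OF assms(1,2)] by blast
qed

lemma word_rel_pres_cong:
  "(u, v) \<in> pres_cong (PB_gens n) (PB_rels n) \<Longrightarrow> word_rel u f g \<longleftrightarrow> word_rel v f g"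
proof (induction arbitrary: f g rule: pres_cong.induct)
  case (rel u v)
  then show ?case by (intro word_rel_PB_rels)
next
  case (mult u v u' v')
  then show ?case unfolding word_rel_append by blast
qed blast+

lemma word_rel_normal_part:
  assumes "w \<in> lists (PB_gens n)"
  obtains u C p v where "PB_rep.valid n u C p v" "word_rel w = part_rel n (normal_part n u C p v)"
    "prod_list (map (T_action n) w) = PB_rep.normal_form n (T_action n) u C p v"
proof -
  interpret PB_rep n "T_action n" by (rule PB_rep_T_action)
  obtain u C p v where d: "prod_list (map (T_action n) w) = normal_form u C p v" "valid u C p v"
    using prod_list_in_normal_forms[OF assms] unfolding normal_forms_def by blast
  obtain w' where w': "w' \<in> lists (PB_gens n)" "prod_list (map (T_action n) w') = normal_form u C p v"
    "word_rel w' = part_rel n (normal_part n u C p v)"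
    using represents_normal_form[OF d(2)] unfolding represents_def by blast
  \<comment> \<open>The word \<open>w'\<close> spells out the normal form of \<open>w\<close>; equal
    values make the two words congruent, and soundness transfers the relation of \<open>w'\<close>
    to \<open>w\<close>.\<close>
  have "(w, w') \<in> pres_cong (PB_gens n) (PB_rels n)"
    using T_action_faithful[OF assms w'(1)] d(1) w'(2) by simp
  then have "word_rel w = word_rel w'" by (intro ext word_rel_pres_cong)
  then show ?thesis using that d w'(3) by simp
qed

text \<open>Completeness of the relations: equal relations give equal partitions, these give equal
  normal forms, and the faithful action returns a congruence of words.\<close>

lemma word_rel_eq_imp_cong:
  assumes "w \<in> lists (PB_gens n)" "w' \<in> lists (PB_gens n)" "word_rel w = word_rel w'"
  shows "(w, w') \<in> pres_cong (PB_gens n) (PB_rels n)"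
proof -
  interpret PB_rep n "T_action n" by (rule PB_rep_T_action)
  obtain u C p v where d: "valid u C p v" "word_rel w = part_rel n (normal_part n u C p v)"
    "prod_list (map (T_action n) w) = normal_form u C p v"
    using word_rel_normal_part[OF assms(1)] .
  obtain u' C' p' v' where d': "valid u' C' p' v'" "word_rel w' = part_rel n (normal_part n u' C' p' v')"
    "prod_list (map (T_action n) w') = normal_form u' C' p' v'"
    using word_rel_normal_part[OF assms(2)] .
  have "normal_part n u C p v = normal_part n u' C' p' v'"
    using partition_on_normal_part[OF validD(1-4)[OF d(1)]] partition_on_normal_part[OF validD(1-4)[OF d'(1)]]
      d(2) d'(2) assms(3) by (intro part_rel_inject) auto
  then show ?thesis
    using normal_form_eqI[OF d(1) d'(1)] d(3) d'(3) T_action_faithful[OF assms(1,2)] by simp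
qed

section \<open>Every partition with blocks of size at most 2 comes from a normal form\<close>

lemma partial_brauer_carrier:
  "\<alpha> \<in> carrier (partial_brauer_monoid n) \<longleftrightarrow> partition_on (points n) \<alpha> \<and> (\<forall>B\<in>\<alpha>. card B \<le> 2)"
  by (simp add: partial_brauer_monoid_def partition_monoid_def)

lemma card_le_2_cases:
  assumes "finite B" "card B \<le> 2" "x \<in> B"
  obtains "B = {x}" | y where "y \<noteq> x" "B = {x, y}"
proof -
  have "card B = 1 \<or> card B = 2" using assms card_gt_0_iff[of B] by auto
  then show ?thesis
  proof
    assume "card B = 1"
    then show ?thesis using that(1) assms(3) by (metis card_1_singletonE singletonD)
  next
    assume "card B = 2"
    then obtain a b where "B = {a, b}" "a \<noteq> b" unfolding card_2_iff by blast
    then show ?thesis using that(2)[of a] that(2)[of b] assms(3) by auto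
  qed
qed

text \<open>A block of \<open>Q\<close> meets some block of \<open>P\<close>, which is itself a
  block of \<open>Q\<close>. Thanks to this, only one inclusion has to be checked when a partition
  is identified.\<close>

lemma partition_on_subset_eq:
  assumes "partition_on A P" "partition_on A Q" "P \<subseteq> Q"
  shows "P = Q"
proof
  show "Q \<subseteq> P"
  proof
    fix B assume B: "B \<in> Q"
    then have "B \<noteq> {}" using partition_onD3[OF assms(2)] by blast
    then obtain x where x: "x \<in> B" by blast
    then have "x \<in> A" using partition_onD1[OF assms(2)] B by blast
    then obtain B' where B': "B' \<in> P" "x \<in> B'" using partition_onD1[OF assms(1)] by blast
    then have "B' = B"
      using disjointD[OF partition_onD2[OF assms(2)], of B' B] assms(3) B x by blast
    then show "B \<in> P" using B' by simp
  qed
qed (rule assms(3))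

lemma partial_brauer_normal_part:
  assumes "\<alpha> \<in> carrier (partial_brauer_monoid n)"
  obtains u C p v where "C \<subseteq> {1..n}" "p permutes {1..n}" "hooks C u" "hooks (p ` C) v"
    "\<alpha> = normal_part n u C p v"
proof -
  have \<alpha>: "partition_on (points n) \<alpha>" and card: "\<And>B. B \<in> \<alpha> \<Longrightarrow> card B \<le> 2"
    using assms unfolding partial_brauer_carrier by blast+
  have same: "B = B'" if "B \<in> \<alpha>" "B' \<in> \<alpha>" "x \<in> B" "x \<in> B'" for B B' x
    using disjointD[OF partition_onD2[OF \<alpha>], of B B'] that by blast
  have pts: "x \<in> points n" if "B \<in> \<alpha>" "x \<in> B" for B x
    using partition_onD1[OF \<alpha>] that by blast
  have ptsU: "Unprimed j \<in> points n \<longleftrightarrow> j \<in> {1..n}" and ptsP: "Primed j \<in> points n \<longleftrightarrow> j \<in> {1..n}" for j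
    by (auto simp: points_def)
  have "finite (points n)" by (simp add: points_def)
  then have fin: "finite B" if "B \<in> \<alpha>" for B
    using partition_onD1[OF \<alpha>] that by (auto intro: finite_subset)
  define u where "u = {B. card B = 2 \<and> Unprimed ` B \<in> \<alpha>}"
  define v where "v = {B. card B = 2 \<and> Primed ` B \<in> \<alpha>}"
  define tr where "tr j k \<longleftrightarrow> {Unprimed j, Primed k} \<in> \<alpha>" for j k
  define C where "C = {j \<in> {1..n}. \<nexists>k. tr j k}"
  define q where "q j = (SOME k. tr j k)" for j
  have trq: "tr j (q j)" if "j \<in> {1..n} - C" for j
    using that someI_ex[of "tr j"] unfolding C_def q_def by blast
  have tr_range: "j \<in> {1..n}" "k \<in> {1..n}" if "tr j k" for j k
    using pts[OF that[unfolded tr_def]] ptsU ptsP by auto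
  have tr_inj1: "k = l" if "tr j k" "tr j l" for j k l
  proof -
    have "{Unprimed j, Primed k} = {Unprimed j, Primed l}"
      using same[OF that[unfolded tr_def], of "Unprimed j"] by simp
    then show ?thesis by (simp add: doubleton_eq_iff)
  qed
  have tr_inj2: "i = j" if "tr i k" "tr j k" for i j k
  proof -
    have "{Unprimed i, Primed k} = {Unprimed j, Primed k}"
      using same[OF that[unfolded tr_def], of "Primed k"] by simp
    then show ?thesis by (simp add: doubleton_eq_iff)
  qed
  have "inj_on q ({1..n} - C)"
  proof (rule inj_onI)
    fix i j assume "i \<in> {1..n} - C" "j \<in> {1..n} - C" "q i = q j"
    then show "i = j" using trq[of i] trq[of j] tr_inj2 by simp
  qed
  moreover have "q ` ({1..n} - C) \<subseteq> {1..n}" using trq tr_range by blast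
  \<comment> \<open>The transversals form a partial bijection between the rows. Any extension to a
    permutation will do.\<close>
  ultimately obtain p where p: "p permutes {1..n}" and pq: "\<And>j. j \<in> {1..n} - C \<Longrightarrow> p j = q j"
    using ex_permutes_extending[of "{1..n}" "{1..n} - C" q] by auto
  have trp: "tr j (p j)" if "j \<in> {1..n} - C" for j
    using trq[OF that] pq[OF that] by simp
  \<comment> \<open>Whatever the extension, \<open>p\<close> maps the upper ends of transversals
    onto the lower ones, so the image of \<open>C\<close> consists of the lower points on no
    transversal.\<close>
  have in_pC: "k \<in> p ` C \<longleftrightarrow> k \<in> {1..n} \<and> (\<nexists>j. tr j k)" for k
  proof
    assume "k \<in> p ` C"
    then obtain i where i: "i \<in> C" "k = p i" by blast
    then have "i \<in> {1..n}" unfolding C_def by blast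
    moreover have False if "tr j k" for j
    proof -
      have j: "j \<in> {1..n} - C" using tr_range(1)[OF that] that unfolding C_def by blast
      then have "p j = k" using tr_inj1[OF trp[OF j] that] by simp
      then have "j = i" using i(2) permutes_inj[OF p] by (metis injD)
      then show False using j i(1) by blast
    qed
    ultimately show "k \<in> {1..n} \<and> (\<nexists>j. tr j k)"
      using i(2) permutes_in_image[OF p, of i] by blast
  next
    assume k: "k \<in> {1..n} \<and> (\<nexists>j. tr j k)"
    then obtain i where i: "i \<in> {1..n}" "k = p i" using permutes_image[OF p] by (metis imageE)
    then have "i \<in> C" using trp[of i] k by blast
    then show "k \<in> p ` C" using i by blast
  qed
  have u: "hooks C u"
  proof (rule hooksI)
    fix B assume B: "B \<in> u"
    then show "card B = 2" by (simp add: u_def)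
    show "B \<subseteq> C"
    proof
      fix i assume i: "i \<in> B"
      have Ui: "Unprimed i \<in> Unprimed ` B" using i by blast
      have "\<not> tr i k" for k
      proof
        assume "tr i k"
        then have "{Unprimed i, Primed k} = Unprimed ` B"
          using B Ui same[of "{Unprimed i, Primed k}" "Unprimed ` B" "Unprimed i"] by (auto simp: u_def tr_def)
        then have "Primed k \<in> Unprimed ` B" by blast
        then show False by blast
      qed
      moreover have "Unprimed i \<in> points n" using B Ui pts by (auto simp: u_def)
      ultimately show "i \<in> C" using ptsU unfolding C_def by blast
    qed
    fix B' assume B': "B' \<in> u" "B \<noteq> B'"
    show "B \<inter> B' = {}"
    proof (rule ccontr)
      assume "B \<inter> B' \<noteq> {}"
      then obtain i where "i \<in> B" "i \<in> B'" by blast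
      then have "Unprimed ` B = Unprimed ` B'"
        using B B'(1) by (intro same[of _ _ "Unprimed i"]) (auto simp: u_def)
      moreover have "inj Unprimed" by (auto intro: injI)
      ultimately show False using B'(2) by (simp add: inj_image_eq_iff)
    qed
  qed
  have v: "hooks (p ` C) v"
  proof (rule hooksI)
    fix B assume B: "B \<in> v"
    then show "card B = 2" by (simp add: v_def)
    show "B \<subseteq> p ` C"
    proof
      fix k assume k: "k \<in> B"
      have Pk: "Primed k \<in> Primed ` B" using k by blast
      have "\<not> tr j k" for j
      proof
        assume "tr j k"
        then have "{Unprimed j, Primed k} = Primed ` B"
          using B Pk same[of "{Unprimed j, Primed k}" "Primed ` B" "Primed k"] by (auto simp: v_def tr_def)
        then have "Unprimed j \<in> Primed ` B" by blast
        then show False by blast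
      qed
      moreover have "Primed k \<in> points n" using B Pk pts by (auto simp: v_def)
      ultimately show "k \<in> p ` C" using ptsP unfolding in_pC by blast
    qed
    fix B' assume B': "B' \<in> v" "B \<noteq> B'"
    show "B \<inter> B' = {}"
    proof (rule ccontr)
      assume "B \<inter> B' \<noteq> {}"
      then obtain i where "i \<in> B" "i \<in> B'" by blast
      then have "Primed ` B = Primed ` B'"
        using B B'(1) by (intro same[of _ _ "Primed i"]) (auto simp: v_def)
      moreover have "inj Primed" by (auto intro: injI)
      ultimately show False using B'(2) by (simp add: inj_image_eq_iff)
    qed
  qed
  have C: "C \<subseteq> {1..n}" unfolding C_def by blast
  have "normal_part n u C p v \<subseteq> \<alpha>"
  proof
    fix B assume "B \<in> normal_part n u C p v"
    then show "B \<in> \<alpha>"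
    proof (cases rule: normal_part_cases)
      case (upper A)
      then show ?thesis by (simp add: u_def)
    next
      case (lower A)
      then show ?thesis by (simp add: v_def)
    next
      case (transversal j)
      then show ?thesis using trp[of j] by (simp add: tr_def)
    next
      case (left j)
      then have "j \<in> C" "j \<notin> \<Union>u" by blast+
      then have "Unprimed j \<in> points n" using C ptsU by blast
      then obtain B' where B': "B' \<in> \<alpha>" "Unprimed j \<in> B'" using partition_onD1[OF \<alpha>] by blast
      have "B' = {Unprimed j}"
        using fin[OF B'(1)] card[OF B'(1)] B'(2)
      proof (cases rule: card_le_2_cases)
        case (2 y)
        show ?thesis
        proof (cases y)
          case (Unprimed i)
          then have "{j, i} \<in> u" using 2 B'(1) by (auto simp: u_def)
          then show ?thesis using \<open>j \<notin> \<Union>u\<close> by blast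
        next
          case (Primed k)
          then have "tr j k" using 2 B'(1) by (simp add: tr_def)
          then show ?thesis using \<open>j \<in> C\<close> unfolding C_def by blast
        qed
      qed
      then show ?thesis using B'(1) left(2) by simp
    next
      case (right j)
      then have j: "j \<in> p ` C" "j \<notin> \<Union>v" by blast+
      then have "Primed j \<in> points n" using ptsP unfolding in_pC by blast
      then obtain B' where B': "B' \<in> \<alpha>" "Primed j \<in> B'" using partition_onD1[OF \<alpha>] by blast
      have "B' = {Primed j}"
        using fin[OF B'(1)] card[OF B'(1)] B'(2)
      proof (cases rule: card_le_2_cases)
        case (2 y)
        show ?thesis
        proof (cases y)
          case (Primed i)
          then have "{j, i} \<in> v" using 2 B'(1) by (auto simp: v_def)
          then show ?thesis using j(2) by blast
        next
          case (Unprimed k)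
          then have "tr k j" using 2 B'(1) by (simp add: tr_def insert_commute)
          then show ?thesis using j(1) unfolding in_pC by blast
        qed
      qed
      then show ?thesis using B'(1) right(2) by simp
    qed
  qed
  then have "\<alpha> = normal_part n u C p v"
    using partition_on_subset_eq[OF partition_on_normal_part[OF C p u v] \<alpha>] by simp
  then show ?thesis using that C p u v by blast
qed

section \<open>Images of the generators and the partition of a word\<close>

lemma normal_part_gens:
  "\<one>\<^bsub>partial_brauer_monoid n\<^esub> = normal_part n {} {} id {}"
  "i \<in> {1..<n} \<Longrightarrow> s_part n i = normal_part n {} {} (transpose i (Suc i)) {}"
  "i \<in> {1..<n} \<Longrightarrow> pi_part n i = normal_part n {{i, Suc i}} {i, Suc i} id {{i, Suc i}}"
  "i \<in> {1..n} \<Longrightarrow> varsigma_part n i = normal_part n {} {i} id {}"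
proof -
  show "\<one>\<^bsub>partial_brauer_monoid n\<^esub> = normal_part n {} {} id {}"
    by (auto simp: partial_brauer_monoid_def partition_monoid_def normal_part_def)
next
  assume i: "i \<in> {1..<n}"
  let ?D = "{j \<in> {1..n}. j \<noteq> i \<and> j \<noteq> i + 1}"
  have n: "{1..n} = insert i (insert (Suc i) ?D)" using i by auto
  have "(\<lambda>j. {Unprimed j, Primed (transpose i (Suc i) j)}) ` ?D = (\<lambda>j. {Unprimed j, Primed j}) ` ?D"
    by (rule image_cong) auto
  then show "s_part n i = normal_part n {} {} (transpose i (Suc i)) {}"
    unfolding s_part_def normal_part_def Diff_empty by (subst n) (auto simp: setcompr_eq_image)
next
  assume i: "i \<in> {1..<n}"
  show "pi_part n i = normal_part n {{i, Suc i}} {i, Suc i} id {{i, Suc i}}"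
    by (auto simp: pi_part_def normal_part_def)
next
  assume i: "i \<in> {1..n}"
  show "varsigma_part n i = normal_part n {} {i} id {}"
    by (auto simp: varsigma_part_def normal_part_def)
qed

lemma all_outside_iff:
  assumes "A \<subseteq> S"
  shows "(\<forall>x. x \<notin> A \<longrightarrow> P x) \<longleftrightarrow> (\<forall>x\<in>S - A. P x) \<and> (\<forall>x. x \<notin> S \<longrightarrow> P x)"
  using assms by blast

lemma word_rel_gens:
  "i \<in> {1..<n} \<Longrightarrow> word_rel [\<sigma> i] f g \<longleftrightarrow> part_rel n (s_part n i) f g"
  "i \<in> {1..<n} \<Longrightarrow> word_rel [\<theta> i] f g \<longleftrightarrow> part_rel n (pi_part n i) f g"
  "i \<in> {1..n} \<Longrightarrow> word_rel [var\<theta> i] f g \<longleftrightarrow> part_rel n (varsigma_part n i) f g"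
  "word_rel [] f g \<longleftrightarrow> part_rel n \<one>\<^bsub>partial_brauer_monoid n\<^esub> f g"
proof -
  show "word_rel [] f g \<longleftrightarrow> part_rel n \<one>\<^bsub>partial_brauer_monoid n\<^esub> f g"
    unfolding normal_part_gens part_rel_normal_part by (auto simp: fun_eq_iff)
next
  assume i: "i \<in> {1..<n}"
  have out: "transpose i (Suc i) j = j" if "j \<notin> {1..n}" for j
    using that i by (intro transpose_apply_other) auto
  have inv: "transpose i (Suc i) (transpose i (Suc i) j) = j" for j by simp
  have "(\<forall>x. f (transpose i (Suc i) x) = g x) \<longleftrightarrow> (\<forall>x. f x = g (transpose i (Suc i) x))"
    using inv by metis
  also have "\<dots> \<longleftrightarrow> (\<forall>j\<in>{1..n}. f j = g (transpose i (Suc i) j)) \<and> (\<forall>j. j \<notin> {1..n} \<longrightarrow> f j = g j)"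
    using out by metis
  finally show "word_rel [\<sigma> i] f g \<longleftrightarrow> part_rel n (s_part n i) f g"
    unfolding normal_part_gens(2)[OF i] part_rel_normal_part word_rel_singleton by simp
next
  assume i: "i \<in> {1..<n}"
  have "(\<forall>x. x \<noteq> i \<longrightarrow> x \<noteq> Suc i \<longrightarrow> f x = g x) \<longleftrightarrow>
      (\<forall>j\<in>{1..n} - {i, Suc i}. f j = g j) \<and> (\<forall>j. j \<notin> {1..n} \<longrightarrow> f j = g j)"
    using all_outside_iff[of "{i, Suc i}" "{1..n}" "\<lambda>j. f j = g j"] i by (simp add: imp_conjL)
  then show "word_rel [\<theta> i] f g \<longleftrightarrow> part_rel n (pi_part n i) f g"
    unfolding normal_part_gens(3)[OF i] part_rel_normal_part word_rel_singleton by auto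
next
  assume i: "i \<in> {1..n}"
  have "(\<forall>x. x \<noteq> i \<longrightarrow> f x = g x) \<longleftrightarrow>
      (\<forall>j\<in>{1..n} - {i}. f j = g j) \<and> (\<forall>j. j \<notin> {1..n} \<longrightarrow> f j = g j)"
    using all_outside_iff[of "{i}" "{1..n}" "\<lambda>j. f j = g j"] i by simp
  then show "word_rel [var\<theta> i] f g \<longleftrightarrow> part_rel n (varsigma_part n i) f g"
    unfolding normal_part_gens(4)[OF i] part_rel_normal_part word_rel_singleton by simp
qed

lemma gens_in_partial_brauer:
  "\<one>\<^bsub>partial_brauer_monoid n\<^esub> \<in> carrier (partial_brauer_monoid n)"
  "i \<in> {1..<n} \<Longrightarrow> s_part n i \<in> carrier (partial_brauer_monoid n)"
  "i \<in> {1..<n} \<Longrightarrow> pi_part n i \<in> carrier (partial_brauer_monoid n)"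
  "i \<in> {1..n} \<Longrightarrow> varsigma_part n i \<in> carrier (partial_brauer_monoid n)"
proof -
  have *: "normal_part n u C p v \<in> carrier (partial_brauer_monoid n)"
    if "C \<subseteq> {1..n}" "p permutes {1..n}" "hooks C u" "hooks (p ` C) v" for u C p v
    using partition_on_normal_part[OF that] card_normal_part[OF that] unfolding partial_brauer_carrier by blast
  show "\<one>\<^bsub>partial_brauer_monoid n\<^esub> \<in> carrier (partial_brauer_monoid n)"
    unfolding normal_part_gens by (rule *) (simp_all add: permutes_id)
  show "s_part n i \<in> carrier (partial_brauer_monoid n)" if i: "i \<in> {1..<n}"
    unfolding normal_part_gens(2)[OF i] using i by (intro * permutes_swap_id) auto
  show "pi_part n i \<in> carrier (partial_brauer_monoid n)" if i: "i \<in> {1..<n}"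
  proof -
    have "hooks {i, Suc i} {{i, Suc i}}" by (simp add: hooks_def)
    then show ?thesis
      unfolding normal_part_gens(3)[OF i] using i by (intro *) (auto simp: permutes_id)
  qed
  show "varsigma_part n i \<in> carrier (partial_brauer_monoid n)" if i: "i \<in> {1..n}"
    unfolding normal_part_gens(4)[OF i] using i by (intro *) (auto simp: permutes_id)
qed

text \<open>Existence is read off the normal form of the word; uniqueness holds because a partition
  is determined by its labellings.\<close>

lemma word_rel_ex1_partition:
  assumes "w \<in> lists (PB_gens n)"
  shows "\<exists>!\<alpha>. \<alpha> \<in> carrier (partial_brauer_monoid n) \<and> word_rel w = part_rel n \<alpha>"
proof (rule ex_ex1I)
  interpret PB_rep n "T_action n" by (rule PB_rep_T_action)
  obtain u C p v where d: "valid u C p v" "word_rel w = part_rel n (normal_part n u C p v)"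
    using word_rel_normal_part[OF assms] .
  note V = validD(1-4)[OF d(1)]
  have "normal_part n u C p v \<in> carrier (partial_brauer_monoid n)"
    using partition_on_normal_part[OF V] card_normal_part[OF V] unfolding partial_brauer_carrier by blast
  then show "\<exists>\<alpha>. \<alpha> \<in> carrier (partial_brauer_monoid n) \<and> word_rel w = part_rel n \<alpha>"
    using d(2) by blast
next
  fix \<alpha> \<beta> assume *: "\<alpha> \<in> carrier (partial_brauer_monoid n) \<and> word_rel w = part_rel n \<alpha>"
    "\<beta> \<in> carrier (partial_brauer_monoid n) \<and> word_rel w = part_rel n \<beta>"
  then show "\<alpha> = \<beta>"
    unfolding partial_brauer_carrier by (intro part_rel_inject) auto
qed

definition word_part :: "nat \<Rightarrow> gen list \<Rightarrow> point set set" where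
  "word_part n w = (THE \<alpha>. \<alpha> \<in> carrier (partial_brauer_monoid n) \<and> word_rel w = part_rel n \<alpha>)"

lemma word_part:
  assumes "w \<in> lists (PB_gens n)"
  shows "word_part n w \<in> carrier (partial_brauer_monoid n)" "word_rel w = part_rel n (word_part n w)"
  using theI'[OF word_rel_ex1_partition[OF assms]] unfolding word_part_def by blast+

lemma word_part_eqI:
  assumes "w \<in> lists (PB_gens n)" "\<alpha> \<in> carrier (partial_brauer_monoid n)"
    "\<And>f g. word_rel w f g \<longleftrightarrow> part_rel n \<alpha> f g"
  shows "word_part n w = \<alpha>"
proof -
  have "word_rel w = part_rel n \<alpha>" using assms(3) by (intro ext)
  then show ?thesis using word_rel_ex1_partition[OF assms(1)] assms(2) word_part[OF assms(1)] by blast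
qed

text \<open>Concatenation of words and gluing of partitions both become composition of relations,
  where they can be compared.\<close>

lemma word_part_append:
  assumes "u \<in> lists (PB_gens n)" "v \<in> lists (PB_gens n)"
  shows "word_part n (u @ v) = part_mult n (word_part n u) (word_part n v)"
proof -
  have uv: "u @ v \<in> lists (PB_gens n)" using assms by simp
  have P: "partition_on (points n) (word_part n w)" if "w \<in> lists (PB_gens n)" for w
    using word_part(1)[OF that] unfolding partial_brauer_carrier by blast
  show ?thesis
  proof (rule part_rel_inject[OF P[OF uv] partition_on_part_mult[OF P[OF assms(1)] P[OF assms(2)]]])
    fix f g
    show "part_rel n (word_part n (u @ v)) f g \<longleftrightarrow> part_rel n (part_mult n (word_part n u) (word_part n v)) f g"
      unfolding part_rel_part_mult[OF P[OF assms(1)] P[OF assms(2)]]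
        word_part(2)[OF uv, symmetric] word_part(2)[OF assms(1), symmetric] word_part(2)[OF assms(2), symmetric]
      by (rule word_rel_append)
  qed
qed

text \<open>One direction makes the map on classes well defined, by soundness; the other makes it
  injective, by completeness.\<close>

lemma word_part_cong_iff:
  assumes "u \<in> lists (PB_gens n)" "v \<in> lists (PB_gens n)"
  shows "word_part n u = word_part n v \<longleftrightarrow> T_class n u = T_class n v"
proof
  assume "word_part n u = word_part n v"
  then have "word_rel u = word_rel v" using word_part(2) assms by metis
  then show "T_class n u = T_class n v"
    by (intro T_class_cong word_rel_eq_imp_cong assms)
next
  assume "T_class n u = T_class n v"
  then have "(u, v) \<in> pres_cong (PB_gens n) (PB_rels n)" using word_class_eq_iff[OF assms] by blast
  then have "word_rel u = word_rel v" by (intro ext word_rel_pres_cong)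
  then show "word_part n u = word_part n v" unfolding word_part_def by simp
qed

lemma word_part_surj:
  assumes "\<alpha> \<in> carrier (partial_brauer_monoid n)"
  obtains w where "w \<in> lists (PB_gens n)" "word_part n w = \<alpha>"
proof -
  interpret PB_rep n "T_action n" by (rule PB_rep_T_action)
  obtain u C p v where d: "C \<subseteq> {1..n}" "p permutes {1..n}" "hooks C u" "hooks (p ` C) v"
    "\<alpha> = normal_part n u C p v"
    using partial_brauer_normal_part[OF assms] .
  then have "valid u C p v" by (simp add: valid_def)
  then obtain w where w: "w \<in> lists (PB_gens n)" "word_rel w = part_rel n \<alpha>"
    using represents_normal_form unfolding represents_def d(5) by blast
  then have "word_part n w = \<alpha>" using assms by (intro word_part_eqI) auto
  then show ?thesis using that w(1) by blast
qed

theorem theorem27: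
  fixes n :: nat
  shows "\<exists>\<phi>. \<phi> \<in> iso (T_monoid n) (partial_brauer_monoid n) \<and>
    \<phi> \<one>\<^bsub>T_monoid n\<^esub> = \<one>\<^bsub>partial_brauer_monoid n\<^esub> \<and>
    (\<forall>i\<in>{1..<n}. \<phi> (T_gen n (\<sigma> i)) = s_part n i) \<and>
    (\<forall>i\<in>{1..<n}. \<phi> (T_gen n (\<theta> i)) = pi_part n i) \<and>
    (\<forall>i\<in>{1..n}. \<phi> (T_gen n (var\<theta> i)) = varsigma_part n i)"
proof -
  let ?L = "lists (PB_gens n)"
  \<comment> \<open>By \<open>word_part_cong_iff\<close> the chosen representative does not
    influence the value.\<close>
  define \<phi> where "\<phi> X = word_part n (SOME w. w \<in> ?L \<and> T_class n w = X)" for X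
  have \<phi>: "\<phi> (T_class n w) = word_part n w" if "w \<in> ?L" for w
  proof -
    have "(SOME w'. w' \<in> ?L \<and> T_class n w' = T_class n w) \<in> ?L \<and>
        T_class n (SOME w'. w' \<in> ?L \<and> T_class n w' = T_class n w) = T_class n w"
      by (rule someI[of _ w]) (use that in simp)
    then show ?thesis unfolding \<phi>_def using word_part_cong_iff that by blast
  qed
  have car: "carrier (T_monoid n) = T_class n ` ?L" by (rule carrier_presented_monoid)
  have hom: "\<phi> \<in> hom (T_monoid n) (partial_brauer_monoid n)"
  proof (rule homI)
    fix X assume "X \<in> carrier (T_monoid n)"
    then obtain u where "u \<in> ?L" "X = T_class n u" unfolding car by blast
    then show "\<phi> X \<in> carrier (partial_brauer_monoid n)" using \<phi> word_part(1) by simp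
  next
    fix X Y assume "X \<in> carrier (T_monoid n)" "Y \<in> carrier (T_monoid n)"
    then obtain u v where uv: "u \<in> ?L" "X = T_class n u" "v \<in> ?L" "Y = T_class n v" unfolding car by blast
    then have "u @ v \<in> ?L" by simp
    then show "\<phi> (X \<otimes>\<^bsub>T_monoid n\<^esub> Y) = \<phi> X \<otimes>\<^bsub>partial_brauer_monoid n\<^esub> \<phi> Y"
      unfolding uv(2,4) mult_presented_monoid[OF uv(1,3)] \<phi>[OF uv(1)] \<phi>[OF uv(3)] \<phi>[OF \<open>u @ v \<in> ?L\<close>]
        word_part_append[OF uv(1,3)]
      by (simp add: partial_brauer_monoid_def partition_monoid_def)
  qed
  have "inj_on \<phi> (carrier (T_monoid n))"
  proof (rule inj_onI)
    fix X Y assume "X \<in> carrier (T_monoid n)" "Y \<in> carrier (T_monoid n)" and eq: "\<phi> X = \<phi> Y"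
    then obtain u v where uv: "u \<in> ?L" "X = T_class n u" "v \<in> ?L" "Y = T_class n v" unfolding car by blast
    with eq show "X = Y" using \<phi> word_part_cong_iff[OF uv(1,3)] by simp
  qed
  moreover have "\<phi> ` carrier (T_monoid n) = carrier (partial_brauer_monoid n)"
  proof
    show "\<phi> ` carrier (T_monoid n) \<subseteq> carrier (partial_brauer_monoid n)"
      using hom unfolding hom_def by blast
    show "carrier (partial_brauer_monoid n) \<subseteq> \<phi> ` carrier (T_monoid n)"
    proof
      fix \<alpha> assume "\<alpha> \<in> carrier (partial_brauer_monoid n)"
      then obtain w where "w \<in> ?L" "word_part n w = \<alpha>" by (rule word_part_surj)
      then show "\<alpha> \<in> \<phi> ` carrier (T_monoid n)"
        unfolding car using \<phi> by (intro image_eqI[of _ _ "T_class n w"] imageI) simp_all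
    qed
  qed
  ultimately have "\<phi> \<in> iso (T_monoid n) (partial_brauer_monoid n)"
    using hom unfolding iso_def bij_betw_def by blast
  moreover have "\<phi> \<one>\<^bsub>T_monoid n\<^esub> = \<one>\<^bsub>partial_brauer_monoid n\<^esub>"
    unfolding one_presented_monoid \<phi>[OF lists.Nil]
    by (rule word_part_eqI[OF lists.Nil gens_in_partial_brauer(1) word_rel_gens(4)])
  moreover have "\<phi> (T_gen n (\<sigma> i)) = s_part n i" "\<phi> (T_gen n (\<theta> i)) = pi_part n i" if i: "i \<in> {1..<n}" for i
  proof -
    have l: "[\<sigma> i] \<in> ?L" "[\<theta> i] \<in> ?L" using i by (auto simp: PB_gens_def)
    show "\<phi> (T_gen n (\<sigma> i)) = s_part n i"
      unfolding \<phi>[OF l(1)] by (rule word_part_eqI[OF l(1) gens_in_partial_brauer(2)[OF i] word_rel_gens(1)[OF i]])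
    show "\<phi> (T_gen n (\<theta> i)) = pi_part n i"
      unfolding \<phi>[OF l(2)] by (rule word_part_eqI[OF l(2) gens_in_partial_brauer(3)[OF i] word_rel_gens(2)[OF i]])
  qed
  moreover have "\<phi> (T_gen n (var\<theta> i)) = varsigma_part n i" if i: "i \<in> {1..n}" for i
  proof -
    have l: "[var\<theta> i] \<in> ?L" using i by (auto simp: PB_gens_def)
    show ?thesis
      unfolding \<phi>[OF l] by (rule word_part_eqI[OF l gens_in_partial_brauer(4)[OF i] word_rel_gens(3)[OF i]])
  qed
  ultimately show ?thesis by blast
qed

end
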